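(* Consider the leader-follower consensus dynamics $\dot{\mathbf{x}}=-A\mathbf{x}+\mathbf{B}u$, $y=\mathbf{x}$, on an all-input two-terminal series-parallel (AITTSP) graph $\mathcal{G}$ with set of leaders $\mathcal{R}$, set of source nodes $R$ and matrix-valued edge weights in $\mathcal{S}_{++}^k$. Then the $\mathcal{H}_2$ norm of this system satisfies $$\left(\mathcal{H}_2^{\mathcal{G},\mathbf{B}}\right)^2=\tfrac12\,\mathrm{Tr}\left[\mathbf{B}^{\intercal}A^{-1}\mathbf{B}\right]=\sum_{s\in R}\left(\mathcal{H}_2^{\mathcal{G},\mathbf{e}_s}\right)^2,$$ where $\mathcal{H}_2^{\mathcal{G},\mathbf{e}_s}$ is the $\mathcal{H}_2$ norm of $\dot{\mathbf{x}}=-A\mathbf{x}+\mathbf{e}_su$, $y=\mathbf{x}$. Moreover, given the edge weights and, for each $s\in R$, a decomposition tree of $\mathcal{G}$ (with the leaders identified to a single node $l$) having source $s$ and sink $l$, this $\mathcal{H}_2$ norm can be computed with best-case complexity $\mathcal{O}(k^\omega|\mathcal{R}|\log|\mathcal{N}|)$ and worst-case complexity $\mathcal{O}(k^\omega|\mathcal{R}||\mathcal{N}|)$.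
   Context: $\mathcal{S}_{++}^k$ is the set of real symmetric positive-definite $k\times k$ matrices; $\mathbf{e}_i=e_i\otimes I_k$. Leader-follower setup: $\mathcal{G}$ is a finite connected simple undirected graph with node set $\mathcal{N}$ and edge weights $W_e\in\mathcal{S}_{++}^k$. $\mathcal{R}\subset\mathcal{N}$ is the set of leaders; the others are followers. Each leader is joined by a single edge, of identity weight, to one follower, distinct leaders to distinct followers, and has no other edges. The followers so attached form the set of source nodes $R=\{i_1,\dots,i_m\}$ (so $|R|=|\mathcal{R}|$). The Dirichlet Laplacian, indexed by followers in $k\times k$ blocks, is $A=\sum_{e=\{i,j\}}(\mathbf{e}_i-\mathbf{e}_j)W_e(\mathbf{e}_i-\mathbf{e}_j)^{\intercal}+\sum_{i\in R}\mathbf{e}_iW_i\mathbf{e}_i^{\intercal}$, the first sum being over edges between followers and $W_i=I_k$ being the weight of the edge from $i$ to its leader; $A$ is positive definite. The input matrix is $\mathbf{B}=[\mathbf{e}_{i_1}\ \cdots\ \mathbf{e}_{i_m}]$. $\mathcal{H}_2$ norm: for $\dot x=Fx+Bu$, $y=Cx$ with transfer function $G(\sigma)=C(\sigma I-F)^{-1}B$, the squared norm is $\frac{1}{2\pi}\int_{-\infty}^{\infty}\mathrm{Tr}[G(j\omega)^*G(j\omega)]\,d\omega$. TTSP graphs (undirected) with a source and a sink are defined recursively: (1) two vertices joined by one edge (a 1-path), one being the source and the other the sink; (2) from disjoint TTSP graphs with sources $s_1,s_2$ and sinks $t_1,t_2$: the parallel join (identify $s_1\sim s_2$ as source, $t_1\sim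 t_2$ as sink) and the series join (identify $t_1\sim s_2$; source $s_1$, sink $t_2$). A decomposition tree of a TTSP graph is a rooted binary tree in which every node has $0$ or $2$ children, every leaf corresponds to a 1-path (an edge of the graph), and every non-leaf corresponds to a series or parallel join of the graphs represented by its two children, the root representing the whole graph. AITTSP: $\mathcal{G}$ is all-input TTSP if, after identifying all leaders to one node $l$ (adjacent to all source nodes), the resulting graph is TTSP with source $s$ and sink $l$ for every $s\in R$. Complexity conventions: inversion or multiplication of $k\times k$ matrices costs $\mathcal{O}(k^\omega)$. Computations attached to different nodes in the same layer (depth) of a decomposition tree are independent and performed simultaneously, so a layer counts as one step. The computations for the different $s\in R$ are performed one after another. "Best case" refers to decomposition trees whose height is of the smallest possible order, $\mathcal{O}(\log|\mathcal{N}|)$; "worst case" refers to arbitrary graphs and decomposition trees. *)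

theory Defs
  imports
    "HOL-Analysis.Lebesgue_Measure"
    "HOL-Analysis.Bochner_Integration"
    "HOL-Library.Landau_Symbols"
    "Jordan_Normal_Form.Gauss_Jordan_Elimination"
    "Jordan_Normal_Form.Schur_Decomposition"
begin

section \<open>Matrices and the \<open>H\<^sub>2\<close> norm\<close>

definition mat_trace :: "'a::comm_monoid_add mat \<Rightarrow> 'a" where
  "mat_trace M = (\<Sum>i<dim_row M. M $$ (i, i))"

definition spd :: "nat \<Rightarrow> real mat set" where
  "spd k = {W \<in> carrier_mat k k. transpose_mat W = W \<and>
     (\<forall>x \<in> carrier_vec k. x \<noteq> 0\<^sub>v k \<longrightarrow> 0 < x \<bullet> (W *\<^sub>v x))}"

text \<open>
  The library inverse \<^const>\<open>mat_inverse\<close> is option-valued; \<open>the\<close> is only meaningful where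
  the inverse exists.
\<close>

definition transfer_function ::
    "real mat \<Rightarrow> real mat \<Rightarrow> real mat \<Rightarrow> complex \<Rightarrow> complex mat" where
  "transfer_function F B C \<sigma> =
     map_mat of_real C *
     the (mat_inverse (\<sigma> \<cdot>\<^sub>m 1\<^sub>m (dim_row F) - map_mat of_real F)) *
     map_mat of_real B"

text \<open>
  The integrand is a trace of the form \<open>Tr (G\<^sup>* G)\<close>, hence real and nonnegative, so taking
  its real part loses nothing.
\<close>

definition h2_norm :: "real mat \<Rightarrow> real mat \<Rightarrow> real mat \<Rightarrow> real" where
  "h2_norm F B C =
     sqrt (1 / (2 * pi) *
       (LINT \<omega>|lborel.
          Re (mat_trace (mat_adjoint (transfer_function F B C (\<i> * of_real \<omega>)) *
                         transfer_function F B C (\<i> * of_real \<omega>)))))"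


section \<open>Leader-follower graphs\<close>

text \<open>An undirected edge is the two-element set of its endpoints.\<close>

record lf_graph =
  nodes :: "nat set"
  edges :: "nat set set"
  leaders :: "nat set"
  weight :: "nat set \<Rightarrow> real mat"

definition simple_graph :: "'v set \<Rightarrow> 'v set set \<Rightarrow> bool" where
  "simple_graph V E \<longleftrightarrow> finite V \<and> E \<subseteq> {{u, v} | u v. u \<in> V \<and> v \<in> V \<and> u \<noteq> v}"

definition connected_graph :: "'v set \<Rightarrow> 'v set set \<Rightarrow> bool" where
  "connected_graph V E \<longleftrightarrow> (\<forall>u\<in>V. \<forall>v\<in>V. (u, v) \<in> {(a, b). {a, b} \<in> E}\<^sup>*)"

definition followers :: "lf_graph \<Rightarrow> nat set" where
  "followers G = nodes G - leaders G"

definition sources :: "lf_graph \<Rightarrow> nat set" where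
  "sources G = {i \<in> followers G. \<exists>r\<in>leaders G. {r, i} \<in> edges G}"

text \<open>
  There is at least one leader: otherwise there is no grounding term and the Dirichlet
  Laplacian would be singular.
\<close>

definition leader_follower :: "nat \<Rightarrow> lf_graph \<Rightarrow> bool" where
  "leader_follower k G \<longleftrightarrow>
     simple_graph (nodes G) (edges G) \<and> connected_graph (nodes G) (edges G) \<and>
     (\<forall>e\<in>edges G. weight G e \<in> spd k) \<and>
     leaders G \<subset> nodes G \<and> leaders G \<noteq> {} \<and>
     (\<forall>r\<in>leaders G. \<exists>i\<in>followers G.
        {e \<in> edges G. r \<in> e} = {{r, i}} \<and> weight G {r, i} = 1\<^sub>m k) \<and>
     (\<forall>r\<in>leaders G. \<forall>r'\<in>leaders G. \<forall>i. {r, i} \<in> edges G \<and> {r', i} \<in> edges G \<longrightarrow> r = r')"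

definition leader_of :: "lf_graph \<Rightarrow> nat \<Rightarrow> nat" where
  "leader_of G i = (THE r. r \<in> leaders G \<and> {r, i} \<in> edges G)"

text \<open>
  Followers are indexed in increasing order: \<open>follower_index G i\<close> is the position of \<open>i\<close>, and
  \<open>block_unit k G i\<close> is \<open>e\<^sub>i \<otimes> I\<^sub>k\<close>. Row \<open>a * k + p\<close> with \<open>p < k\<close> is row \<open>p\<close> of block \<open>a\<close>.
\<close>

definition follower_index :: "lf_graph \<Rightarrow> nat \<Rightarrow> nat" where
  "follower_index G i = card {j \<in> followers G. j < i}"

definition state_dim :: "nat \<Rightarrow> lf_graph \<Rightarrow> nat" where
  "state_dim k G = card (followers G) * k"

definition block_unit :: "nat \<Rightarrow> lf_graph \<Rightarrow> nat \<Rightarrow> real mat" where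
  "block_unit k G i =
     mat (state_dim k G) k (\<lambda>(r, c). if r = follower_index G i * k + c then 1 else 0)"

text \<open>
  Type \<open>mat\<close> has no global zero, so the sums of matrices are taken entrywise. The summand of
  an edge does not depend on which endpoint gets the minus sign.
\<close>

definition dirichlet_laplacian :: "nat \<Rightarrow> lf_graph \<Rightarrow> real mat" where
  "dirichlet_laplacian k G = mat (state_dim k G) (state_dim k G) (\<lambda>rc.
     (\<Sum>e \<in> {e \<in> edges G. e \<subseteq> followers G}.
        ((block_unit k G (Min e) - block_unit k G (Max e)) * weight G e *
         transpose_mat (block_unit k G (Min e) - block_unit k G (Max e))) $$ rc) +
     (\<Sum>i \<in> sources G.
        (block_unit k G i * weight G {leader_of G i, i} *
         transpose_mat (block_unit k G i)) $$ rc))"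

definition input_matrix :: "nat \<Rightarrow> lf_graph \<Rightarrow> real mat" where
  "input_matrix k G = mat (state_dim k G) (card (sources G) * k) (\<lambda>(r, c).
     block_unit k G (sorted_list_of_set (sources G) ! (c div k)) $$ (r, c mod k))"

text \<open>The norm of \<open>x' = -A x + B u\<close>, \<open>y = x\<close>.\<close>

definition consensus_h2 :: "nat \<Rightarrow> lf_graph \<Rightarrow> real mat \<Rightarrow> real" where
  "consensus_h2 k G B = h2_norm (- dirichlet_laplacian k G) B (1\<^sub>m (state_dim k G))"


section \<open>Two-terminal series-parallel graphs\<close>

text \<open>
  Gluing disjoint copies along terminals is expressed by the glued graph itself: the two
  operands are subgraphs that share exactly the identified vertices. Only simple graphs are
  represented, so a parallel join must not create a double edge; this excludes nothing, since
  in any construction of a simple graph all intermediate graphs are subgraphs of it, hence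
  simple. In a series join the edge sets are automatically disjoint.
\<close>

inductive ttsp :: "'v set \<Rightarrow> 'v set set \<Rightarrow> 'v \<Rightarrow> 'v \<Rightarrow> bool" where
  edge: "s \<noteq> t \<Longrightarrow> ttsp {s, t} {{s, t}} s t"
| parallel: "ttsp V1 E1 s t \<Longrightarrow> ttsp V2 E2 s t \<Longrightarrow> V1 \<inter> V2 = {s, t} \<Longrightarrow> E1 \<inter> E2 = {}
    \<Longrightarrow> ttsp (V1 \<union> V2) (E1 \<union> E2) s t"
| series: "ttsp V1 E1 s c \<Longrightarrow> ttsp V2 E2 c t \<Longrightarrow> V1 \<inter> V2 = {c}
    \<Longrightarrow> ttsp (V1 \<union> V2) (E1 \<union> E2) s t"

datatype 'e sp_tree = Leaf 'e | Series "'e sp_tree" "'e sp_tree" | Parallel "'e sp_tree" "'e sp_tree"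

inductive decomposition_tree ::
    "'v set sp_tree \<Rightarrow> 'v set \<Rightarrow> 'v set set \<Rightarrow> 'v \<Rightarrow> 'v \<Rightarrow> bool" where
  leaf: "s \<noteq> t \<Longrightarrow> decomposition_tree (Leaf {s, t}) {s, t} {{s, t}} s t"
| parallel: "decomposition_tree T1 V1 E1 s t \<Longrightarrow> decomposition_tree T2 V2 E2 s t
    \<Longrightarrow> V1 \<inter> V2 = {s, t} \<Longrightarrow> E1 \<inter> E2 = {}
    \<Longrightarrow> decomposition_tree (Parallel T1 T2) (V1 \<union> V2) (E1 \<union> E2) s t"
| series: "decomposition_tree T1 V1 E1 s c \<Longrightarrow> decomposition_tree T2 V2 E2 c t
    \<Longrightarrow> V1 \<inter> V2 = {c}
    \<Longrightarrow> decomposition_tree (Series T1 T2) (V1 \<union> V2) (E1 \<union> E2) s t"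

lemma ttsp_iff_decomposition_tree: "ttsp V E s t \<longleftrightarrow> (\<exists>T. decomposition_tree T V E s t)"
proof
  show "ttsp V E s t \<Longrightarrow> \<exists>T. decomposition_tree T V E s t"
    by (induction rule: ttsp.induct) (blast intro: decomposition_tree.intros)+
  assume "\<exists>T. decomposition_tree T V E s t"
  then obtain T where "decomposition_tree T V E s t" ..
  then show "ttsp V E s t"
    by (induction rule: decomposition_tree.induct) (blast intro: ttsp.intros)+
qed

fun tree_height :: "'e sp_tree \<Rightarrow> nat" where
  "tree_height (Leaf e) = 0"
| "tree_height (Series a b) = Suc (max (tree_height a) (tree_height b))"
| "tree_height (Parallel a b) = Suc (max (tree_height a) (tree_height b))"

text \<open>Identifying all leaders to one node \<open>l\<close>, which is the value \<^const>\<open>None\<close>.\<close>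

definition merge :: "lf_graph \<Rightarrow> nat \<Rightarrow> nat option" where
  "merge G v = (if v \<in> leaders G then None else Some v)"

definition merged_nodes :: "lf_graph \<Rightarrow> nat option set" where
  "merged_nodes G = merge G ` nodes G"

definition merged_edges :: "lf_graph \<Rightarrow> nat option set set" where
  "merged_edges G = (\<lambda>e. merge G ` e) ` edges G"

text \<open>
  In a leader-follower graph merging is injective on edges, because distinct leaders are joined
  to distinct followers; so every merged edge inherits the weight of a unique edge.
\<close>

definition merged_weight :: "lf_graph \<Rightarrow> nat option set \<Rightarrow> real mat" where
  "merged_weight G e = weight G (inv_into (edges G) (\<lambda>e. merge G ` e) e)"

definition aittsp :: "lf_graph \<Rightarrow> bool" where
  "aittsp G \<longleftrightarrow> (\<forall>s\<in>sources G. ttsp (merged_nodes G) (merged_edges G) (Some s) None)"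

definition source_trees :: "lf_graph \<Rightarrow> (nat \<Rightarrow> nat option set sp_tree) \<Rightarrow> bool" where
  "source_trees G D \<longleftrightarrow> (\<forall>s\<in>sources G.
     decomposition_tree (D s) (merged_nodes G) (merged_edges G) (Some s) None)"


section \<open>Computations on decomposition trees and their cost\<close>

text \<open>
  Expressions over \<open>k \<times> k\<close> matrices and over scalars. \<open>MVar i\<close> reads the \<open>i\<close>-th matrix operand,
  \<open>SAcc\<close> reads a scalar accumulator. Evaluation fails (\<^const>\<open>None\<close>) on inverting a singular
  matrix or on reading a missing operand.
\<close>

datatype mexpr =
  MVar nat | MId | MScale rat mexpr | MAdd mexpr mexpr | MMul mexpr mexpr | MInv mexpr

datatype sexpr =
  SAcc | SConst rat | STrace mexpr | SAdd sexpr sexpr | SMul sexpr sexpr | SSqrt sexpr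

fun meval :: "nat \<Rightarrow> real mat list \<Rightarrow> mexpr \<Rightarrow> real mat option" where
  "meval k env (MVar i) = (if i < length env then Some (env ! i) else None)"
| "meval k env MId = Some (1\<^sub>m k)"
| "meval k env (MScale q a) = map_option (\<lambda>X. of_rat q \<cdot>\<^sub>m X) (meval k env a)"
| "meval k env (MAdd a b) = (case (meval k env a, meval k env b) of
      (Some X, Some Y) \<Rightarrow> Some (X + Y) | _ \<Rightarrow> None)"
| "meval k env (MMul a b) = (case (meval k env a, meval k env b) of
      (Some X, Some Y) \<Rightarrow> Some (X * Y) | _ \<Rightarrow> None)"
| "meval k env (MInv a) = (case meval k env a of Some X \<Rightarrow> mat_inverse X | None \<Rightarrow> None)"

fun seval :: "nat \<Rightarrow> real mat list \<Rightarrow> real \<Rightarrow> sexpr \<Rightarrow> real option" where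
  "seval k env acc SAcc = Some acc"
| "seval k env acc (SConst q) = Some (of_rat q)"
| "seval k env acc (STrace a) = map_option mat_trace (meval k env a)"
| "seval k env acc (SAdd a b) = (case (seval k env acc a, seval k env acc b) of
      (Some x, Some y) \<Rightarrow> Some (x + y) | _ \<Rightarrow> None)"
| "seval k env acc (SMul a b) = (case (seval k env acc a, seval k env acc b) of
      (Some x, Some y) \<Rightarrow> Some (x * y) | _ \<Rightarrow> None)"
| "seval k env acc (SSqrt a) = map_option sqrt (seval k env acc a)"

text \<open>
  Number of scalar operations needed to multiply, respectively invert, \<open>k \<times> k\<close> matrices: both
  \<open>O(k\<^sup>\<omega>)\<close>. Entrywise operations on matrices cost \<open>k\<^sup>2\<close>, which is \<open>O(k\<^sup>\<omega>)\<close> since \<open>2 \<le> \<omega>\<close> for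
  every exponent of matrix multiplication.
\<close>

record matrix_costs =
  mult_cost :: "nat \<Rightarrow> nat"
  inv_cost :: "nat \<Rightarrow> nat"

definition matrix_exponent :: "real \<Rightarrow> matrix_costs \<Rightarrow> bool" where
  "matrix_exponent \<omega> mc \<longleftrightarrow> 2 \<le> \<omega> \<and>
     (\<lambda>k. real (mult_cost mc k)) \<in> O(\<lambda>k. real k powr \<omega>) \<and>
     (\<lambda>k. real (inv_cost mc k)) \<in> O(\<lambda>k. real k powr \<omega>)"

fun mcost :: "matrix_costs \<Rightarrow> nat \<Rightarrow> mexpr \<Rightarrow> nat" where
  "mcost mc k (MVar i) = k\<^sup>2"
| "mcost mc k MId = k\<^sup>2"
| "mcost mc k (MScale q a) = mcost mc k a + k\<^sup>2"
| "mcost mc k (MAdd a b) = mcost mc k a + mcost mc k b + k\<^sup>2"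
| "mcost mc k (MMul a b) = mcost mc k a + mcost mc k b + mult_cost mc k"
| "mcost mc k (MInv a) = mcost mc k a + inv_cost mc k"

fun scost :: "matrix_costs \<Rightarrow> nat \<Rightarrow> sexpr \<Rightarrow> nat" where
  "scost mc k SAcc = 1"
| "scost mc k (SConst q) = 1"
| "scost mc k (STrace a) = mcost mc k a + k"
| "scost mc k (SAdd a b) = scost mc k a + scost mc k b + 1"
| "scost mc k (SMul a b) = scost mc k a + scost mc k b + 1"
| "scost mc k (SSqrt a) = scost mc k a + 1"

text \<open>
  An algorithm attaches a fixed expression to each kind of tree node: to a leaf (operand: the
  weight of its edge) and to a series or parallel join (operands: the values computed at the two
  children). For each source in turn, \<open>accumulate\<close> updates a scalar, initially \<open>0\<close>, from the
  value at the root of that source's tree; \<open>finish\<close> turns the final scalar into the output. The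
  expressions are fixed once and for all, independently of \<open>k\<close>, the graph, the weights and the
  trees.
\<close>

record tree_algorithm =
  at_leaf :: mexpr
  at_series :: mexpr
  at_parallel :: mexpr
  accumulate :: sexpr
  finish :: sexpr

fun tree_value :: "tree_algorithm \<Rightarrow> nat \<Rightarrow> ('e \<Rightarrow> real mat) \<Rightarrow> 'e sp_tree \<Rightarrow> real mat option" where
  "tree_value alg k w (Leaf e) = meval k [w e] (at_leaf alg)"
| "tree_value alg k w (Series a b) = (case (tree_value alg k w a, tree_value alg k w b) of
      (Some X, Some Y) \<Rightarrow> meval k [X, Y] (at_series alg) | _ \<Rightarrow> None)"
| "tree_value alg k w (Parallel a b) = (case (tree_value alg k w a, tree_value alg k w b) of
      (Some X, Some Y) \<Rightarrow> meval k [X, Y] (at_parallel alg) | _ \<Rightarrow> None)"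

fun accumulate_trees ::
    "tree_algorithm \<Rightarrow> nat \<Rightarrow> ('e \<Rightarrow> real mat) \<Rightarrow> 'e sp_tree list \<Rightarrow> real \<Rightarrow> real option" where
  "accumulate_trees alg k w [] acc = Some acc"
| "accumulate_trees alg k w (T # Ts) acc = (case tree_value alg k w T of
      Some X \<Rightarrow> (case seval k [X] acc (accumulate alg) of
          Some acc' \<Rightarrow> accumulate_trees alg k w Ts acc' | None \<Rightarrow> None)
    | None \<Rightarrow> None)"

definition algorithm_output ::
    "tree_algorithm \<Rightarrow> nat \<Rightarrow> lf_graph \<Rightarrow> (nat \<Rightarrow> nat option set sp_tree) \<Rightarrow> real option" where
  "algorithm_output alg k G D =
     (case accumulate_trees alg k (merged_weight G) (map D (sorted_list_of_set (sources G))) 0 of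
        Some acc \<Rightarrow> seval k [] acc (finish alg) | None \<Rightarrow> None)"

text \<open>
  Nodes at the same depth are processed simultaneously, so a layer takes as long as the most
  expensive of its nodes. Different sources are processed one after another.
\<close>

fun layer_node_costs ::
    "tree_algorithm \<Rightarrow> matrix_costs \<Rightarrow> nat \<Rightarrow> 'e sp_tree \<Rightarrow> nat \<Rightarrow> nat set" where
  "layer_node_costs alg mc k (Leaf e) 0 = {mcost mc k (at_leaf alg)}"
| "layer_node_costs alg mc k (Series a b) 0 = {mcost mc k (at_series alg)}"
| "layer_node_costs alg mc k (Parallel a b) 0 = {mcost mc k (at_parallel alg)}"
| "layer_node_costs alg mc k (Leaf e) (Suc d) = {}"
| "layer_node_costs alg mc k (Series a b) (Suc d) =
     layer_node_costs alg mc k a d \<union> layer_node_costs alg mc k b d"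
| "layer_node_costs alg mc k (Parallel a b) (Suc d) =
     layer_node_costs alg mc k a d \<union> layer_node_costs alg mc k b d"

definition tree_cost :: "tree_algorithm \<Rightarrow> matrix_costs \<Rightarrow> nat \<Rightarrow> 'e sp_tree \<Rightarrow> nat" where
  "tree_cost alg mc k T = (\<Sum>d\<le>tree_height T. Max (layer_node_costs alg mc k T d))"

definition algorithm_cost ::
    "tree_algorithm \<Rightarrow> matrix_costs \<Rightarrow> nat \<Rightarrow> lf_graph \<Rightarrow> (nat \<Rightarrow> nat option set sp_tree) \<Rightarrow> nat"
  where
  "algorithm_cost alg mc k G D =
     (\<Sum>s\<in>sources G. tree_cost alg mc k (D s) + scost mc k (accumulate alg)) +
     scost mc k (finish alg)"

end

theory Submission
  imports Defs
    "HOL-Analysis.Interval_Integral"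
    "Jordan_Normal_Form.Jordan_Normal_Form_Existence"
    "Jordan_Normal_Form.Jordan_Normal_Form_Uniqueness"
begin

text \<open>
  Since \<open>A\<close> is symmetric positive definite it is diagonalizable with positive eigenvalues
  \<open>d\<^sub>i\<close>, so the integrand of the squared norm is a combination \<open>\<Sum>\<^sub>i c\<^sub>i / (d\<^sub>i\<^sup>2 + \<omega>\<^sup>2)\<close>, and
  \<open>\<integral> d\<omega> / (d\<^sup>2 + \<omega>\<^sup>2) = \<pi> / d\<close> gives half the trace of \<open>B\<^sup>T A\<inverse> B\<close>, which splits into one
  diagonal block of \<open>A\<inverse>\<close> per source.

  The block of \<open>A\<inverse>\<close> at a source \<open>s\<close> is the matrix-valued effective resistance between \<open>s\<close> and the
  merged leader: a solution of \<open>A x = e\<^sub>s i\<close> is a system of potentials that vanishes at the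
  leader and satisfies Kirchhoff's current law with the current \<open>i\<close> injected at \<open>s\<close>. On a
  series-parallel graph resistances add in series and their inverses add in parallel, which the
  decomposition tree evaluates bottom up with boundedly many matrix operations per node. As the
  graph is simple, the height of the tree is less than twice the number of nodes.
\<close>

section \<open>Symmetric positive definite matrices and the norm\<close>

text \<open>Diagonalization goes through the complex Jordan normal form, so the change of basis
  \<open>P\<close> is invertible but not known to be unitary. The adjoint of the resolvent is
  therefore found by uniqueness of inverses instead of being read off the diagonal form, and nothing
  is claimed about the sign of the coefficients c_i. It is enough that the same c_i occur in the
  integrand and in the trace of B^T A^-1 B. Matrix weights need not commute, and a resistance acts
  on vector currents. The induction over the tree therefore asserts, for every injected current,
  that suitable potentials exist; it says nothing about their uniqueness, which is supplied once, at
  the end, by the invertibility of A. It also keeps every resistance in \<open>spd k\<close>, which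
  guarantees that no inversion in the algorithm fails. The cost bounds need constants independent of
  k, of the graph and of the trees. Hence the asymptotic bound on inversion is first turned into one
  for all k >= 1. Additive constants are absorbed because a leader and a follower exist, so that |N|
  >= 2 and ln |N| >= ln 2.\<close>

lemma spd_carrier: "W \<in> spd k \<Longrightarrow> W \<in> carrier_mat k k"
  by (simp add: spd_def)

lemma spd_transpose: "W \<in> spd k \<Longrightarrow> transpose_mat W = W"
  by (simp add: spd_def)

lemma spd_pos: "W \<in> spd k \<Longrightarrow> x \<in> carrier_vec k \<Longrightarrow> x \<noteq> 0\<^sub>v k \<Longrightarrow> 0 < x \<bullet> (W *\<^sub>v x)"
  by (simp add: spd_def)

text \<open>A right inverse of a square matrix is two-sided, and inverses are unique. Later
  identifications of inverses thereby reduce to computing one product.\<close>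

lemma mat_inverse_eqI:
  fixes A :: "'a::field mat"
  assumes A: "A \<in> carrier_mat n n" and B: "B \<in> carrier_mat n n" and AB: "A * B = 1\<^sub>m n"
  shows "mat_inverse A = Some B"
proof -
  have BA: "B * A = 1\<^sub>m n" by (rule mat_mult_left_right_inverse[OF A B AB])
  have "A \<in> Units (ring_mat TYPE('a) n ())"
    unfolding Units_def using A B AB BA by (auto simp: ring_mat_simps)
  then obtain C where C: "mat_inverse A = Some C" using mat_inverse(1)[OF A, where b = "()"] by (cases "mat_inverse A") auto
  note CC = mat_inverse(2)[OF A C]
  have "C = C * (A * B)" using CC AB by (metis right_mult_one_mat)
  also have "\<dots> = (C * A) * B" using CC A B by (intro assoc_mult_mat[symmetric]) auto
  also have "\<dots> = B" using CC B by simp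
  finally show ?thesis using C by simp
qed

lemma mat_inverse_exists:
  fixes A :: "'a::field mat"
  assumes A: "A \<in> carrier_mat n n" and inj: "\<And>v. v \<in> carrier_vec n \<Longrightarrow> A *\<^sub>v v = 0\<^sub>v n \<Longrightarrow> v = 0\<^sub>v n"
  obtains B where "mat_inverse A = Some B" "B \<in> carrier_mat n n" "A * B = 1\<^sub>m n" "B * A = 1\<^sub>m n"
proof -
  have "det A \<noteq> 0" using det_0_iff_vec_prod_zero_field[OF A] inj by blast
  then have "A \<in> Units (ring_mat TYPE('a) n ())" by (rule det_non_zero_imp_unit[OF A])
  then obtain B where B: "mat_inverse A = Some B"
    using mat_inverse(1)[OF A, where b = "()"] by (cases "mat_inverse A") auto
  with mat_inverse(2)[OF A B] that show thesis by blast
qed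

text \<open>The form of \<open>U\<close> at x is the form of \<open>W\<close> at y = U x, because x
  = W y. Membership of \<open>U\<close> in \<open>spd k\<close> allows further inversions further up
  a decomposition tree.\<close>

lemma spd_inverse:
  assumes W: "W \<in> spd k"
  obtains U where "mat_inverse W = Some U" "U \<in> spd k" "W * U = 1\<^sub>m k" "U * W = 1\<^sub>m k"
proof -
  note Wc = spd_carrier[OF W]
  have inj: "v = 0\<^sub>v k" if "v \<in> carrier_vec k" "W *\<^sub>v v = 0\<^sub>v k" for v
    using spd_pos[OF W that(1)] that by fastforce
  obtain U where U: "mat_inverse W = Some U" "U \<in> carrier_mat k k" "W * U = 1\<^sub>m k" "U * W = 1\<^sub>m k"
    using mat_inverse_exists[OF Wc inj] by blast
  have "transpose_mat U * W = 1\<^sub>m k"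
    using arg_cong[OF U(3), of transpose_mat]
    unfolding transpose_mult[OF Wc U(2)] spd_transpose[OF W] by simp
  then have "transpose_mat U = U"
    using U Wc by (metis assoc_mult_mat left_mult_one_mat right_mult_one_mat transpose_carrier_mat)
  moreover have "0 < x \<bullet> (U *\<^sub>v x)" if x: "x \<in> carrier_vec k" "x \<noteq> 0\<^sub>v k" for x
  proof -
    define y where "y = U *\<^sub>v x"
    have y: "y \<in> carrier_vec k" using U x by (auto simp: y_def)
    have xy: "x = W *\<^sub>v y"
      unfolding y_def using U Wc x by (metis assoc_mult_mat_vec one_mult_mat_vec)
    have "y \<noteq> 0\<^sub>v k" using x xy Wc by auto
    from spd_pos[OF W y this] have "0 < y \<bullet> x" by (simp add: xy)
    then show ?thesis using x y by (simp add: y_def[symmetric] comm_scalar_prod[of x k])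
  qed
  ultimately have "U \<in> spd k" using U by (simp add: spd_def)
  with U that show thesis by blast
qed

lemma spd_add:
  assumes "U \<in> spd k" "W \<in> spd k"
  shows "U + W \<in> spd k"
proof -
  note c = assms[THEN spd_carrier]
  have "0 < x \<bullet> ((U + W) *\<^sub>v x)" if x: "x \<in> carrier_vec k" "x \<noteq> 0\<^sub>v k" for x
  proof -
    have "x \<bullet> ((U + W) *\<^sub>v x) = x \<bullet> (U *\<^sub>v x) + x \<bullet> (W *\<^sub>v x)"
      using c x by (simp add: add_mult_distrib_mat_vec[of _ k k] scalar_prod_add_distrib[of _ k])
    then show ?thesis using spd_pos[OF assms(1) x] spd_pos[OF assms(2) x] by simp
  qed
  then show ?thesis using c assms[THEN spd_transpose] by (simp add: spd_def transpose_add[of _ k k])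
qed

text \<open>The antiderivative is arctan (x / l) / l, with limits pi / (2 l) and - pi / (2 l) at the
  two ends. As the integrand is nonnegative, the fundamental theorem on the whole line yields
  integrability as well.\<close>

lemma integral_inverse_square_plus:
  fixes l :: real assumes l: "0 < l"
  shows "integrable lborel (\<lambda>x. 1 / (l\<^sup>2 + x\<^sup>2))" and "(LINT x|lborel. 1 / (l\<^sup>2 + x\<^sup>2)) = pi / l"
proof -
  let ?f = "\<lambda>x::real. 1 / (l\<^sup>2 + x\<^sup>2)" and ?F = "\<lambda>x. arctan (inverse l * x) / l"
  have pos: "0 < l\<^sup>2 + x\<^sup>2" for x using l by (simp add: add_pos_nonneg)
  have F: "DERIV ?F x :> ?f x" for x
  proof -
    have "DERIV ?F x :> (inverse (1 + (inverse l * x)\<^sup>2) * inverse l) / l"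
      using l by (auto intro!: derivative_eq_intros)
    also have "(inverse (1 + (inverse l * x)\<^sup>2) * inverse l) / l = ?f x"
      using l pos[of x] by (simp add: divide_simps power2_eq_square)
    finally show ?thesis .
  qed
  have f: "isCont ?f x" for x
    using pos[of x] by (intro continuous_intros) auto
  have "filterlim (\<lambda>x. inverse l * x) at_top at_top"
    using l by (intro filterlim_tendsto_pos_mult_at_top[OF tendsto_const] filterlim_ident) auto
  then have top: "(?F \<longlongrightarrow> (pi / 2) / l) at_top"
    using l by (intro tendsto_divide tendsto_const filterlim_compose[OF tendsto_arctan_at_top]) auto
  have "filterlim (\<lambda>x. inverse l * x) at_bot at_bot"
    using l by (intro filterlim_tendsto_pos_mult_at_bot[OF tendsto_const] filterlim_ident) auto
  then have bot: "(?F \<longlongrightarrow> (- (pi / 2)) / l) at_bot"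
    using l by (intro tendsto_divide tendsto_const filterlim_compose[OF tendsto_arctan_at_bot]) auto
  have *: "set_integrable lborel (einterval (-\<infinity>) \<infinity>) ?f"
    "(LBINT x=-\<infinity>..\<infinity>. ?f x) = (pi / 2) / l - (- (pi / 2)) / l"
    using top bot
    by (intro interval_integral_FTC_nonneg[where F = ?F] F f;
        simp add: ereal_tendsto_simps less_imp_le[OF pos])+
  show "integrable lborel ?f" using *(1) by (simp add: set_integrable_def)
  show "(LINT x|lborel. ?f x) = pi / l"
    using *(2) by (simp add: interval_integral_eq_integral[symmetric] interval_lebesgue_integral_def set_lebesgue_integral_def)
qed

section \<open>Diagonalization of positive definite matrices\<close>

lemma conjugate_mult_mat_vec_of_real:
  fixes v :: "complex vec"
  assumes A: "A \<in> carrier_mat n n" and v: "v \<in> carrier_vec n"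
  shows "conjugate (map_mat of_real A *\<^sub>v v) = map_mat of_real A *\<^sub>v conjugate v"
  using A v by (intro eq_vecI) (auto simp: scalar_prod_def conjugate_complex_def intro!: sum.cong)

lemma symmetric_cscalar_prod:
  fixes v w :: "complex vec"
  assumes A: "A \<in> carrier_mat n n" and sym: "transpose_mat A = A"
    and v: "v \<in> carrier_vec n" and w: "w \<in> carrier_vec n"
  shows "(map_mat of_real A *\<^sub>v v) \<bullet>c w = v \<bullet>c (map_mat of_real A *\<^sub>v w)"
proof -
  let ?A = "map_mat of_real A :: complex mat"
  have Ac: "?A \<in> carrier_mat n n" using A by simp
  have sym': "transpose_mat ?A = ?A" by (metis map_mat_transpose sym)
  have "(?A *\<^sub>v v) \<bullet>c w = conjugate w \<bullet> (?A *\<^sub>v v)"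
    using Ac v w by (simp add: comm_scalar_prod[of _ n])
  also have "\<dots> = (transpose_mat ?A *\<^sub>v conjugate w) \<bullet> v"
    using transpose_vec_mult_scalar[OF Ac v, of "conjugate w"] w by simp
  also have "\<dots> = (?A *\<^sub>v conjugate w) \<bullet> v" unfolding sym' ..
  also have "\<dots> = v \<bullet>c (?A *\<^sub>v w)"
    using Ac v w by (simp add: comm_scalar_prod[of _ n] conjugate_mult_mat_vec_of_real[OF A w])
  finally show ?thesis .
qed

lemma symmetric_eigenvalue_real:
  assumes A: "A \<in> carrier_mat n n" and sym: "transpose_mat A = A"
    and v: "v \<in> carrier_vec n" "v \<noteq> 0\<^sub>v n" and ev: "map_mat of_real A *\<^sub>v v = a \<cdot>\<^sub>v v"
  shows "cnj a = (a :: complex)"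
proof -
  have "a * (v \<bullet>c v) = (map_mat of_real A *\<^sub>v v) \<bullet>c v" using v by (simp add: ev)
  also have "\<dots> = v \<bullet>c (map_mat of_real A *\<^sub>v v)" by (rule symmetric_cscalar_prod[OF A sym v(1) v(1)])
  also have "\<dots> = v \<bullet>c (a \<cdot>\<^sub>v v)" by (simp add: ev)
  also have "\<dots> = cnj a * (v \<bullet>c v)" using v by (simp add: conjugate_smult_vec conjugate_complex_def)
  finally show ?thesis using conjugate_square_eq_0_vec[OF v(1)] v(2) by simp
qed

text \<open>Positivity in \<open>spd\<close> concerns real vectors only, whereas the eigenvector is
  complex. Since the eigenvalue is real, the real and imaginary parts of \<open>v\<close> both
  satisfy the eigenvalue equation, and at least one of them is nonzero.\<close>

lemma spd_eigenvalue_pos: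
  assumes A: "A \<in> spd n"
    and v: "v \<in> carrier_vec n" "v \<noteq> 0\<^sub>v n" and ev: "map_mat of_real A *\<^sub>v v = a \<cdot>\<^sub>v v"
  shows "a = of_real (Re a) \<and> 0 < Re a"
proof -
  note Ac = spd_carrier[OF A]
  have "cnj a = a" by (rule symmetric_eigenvalue_real[OF Ac spd_transpose[OF A] v ev])
  then have a: "a = of_real (Re a)" by (metis Reals_cnj_iff of_real_Re)
  have entry: "(\<Sum>j<n. of_real (A $$ (i, j)) * v $ j) = of_real (Re a) * v $ i" if i: "i < n" for i
  proof -
    have "(map_mat of_real A *\<^sub>v v) $ i = (a \<cdot>\<^sub>v v) $ i" by (simp add: ev)
    then show ?thesis using Ac v i a
      by (simp add: scalar_prod_def atLeast0LessThan)
  qed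
  have pos: "0 < Re a"
    if x: "x \<in> carrier_vec n" "x \<noteq> 0\<^sub>v n" and e: "A *\<^sub>v x = Re a \<cdot>\<^sub>v x" for x
  proof -
    have "0 < Re a * (x \<bullet> x)" using spd_pos[OF A x] x(1) by (simp add: e)
    moreover have "0 < x \<bullet> x" using conjugate_square_greater_0_vec[OF x(1)] x(2) by simp
    ultimately show ?thesis by (simp add: zero_less_mult_iff)
  qed
  have re: "A *\<^sub>v map_vec Re v = Re a \<cdot>\<^sub>v map_vec Re v"
    using Ac v(1) arg_cong[OF entry, of _ Re]
    by (intro eq_vecI) (auto simp: scalar_prod_def atLeast0LessThan)
  have im: "A *\<^sub>v map_vec Im v = Re a \<cdot>\<^sub>v map_vec Im v"
    using Ac v(1) arg_cong[OF entry, of _ Im]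
    by (intro eq_vecI) (auto simp: scalar_prod_def atLeast0LessThan)
  obtain i where i: "i < n" "v $ i \<noteq> 0" using v by (metis carrier_vecD eq_vecI index_zero_vec)
  then have "map_vec Re v $ i \<noteq> 0 \<or> map_vec Im v $ i \<noteq> 0" using v(1) by (auto simp: complex_eq_iff)
  then have "map_vec Re v \<noteq> 0\<^sub>v n \<or> map_vec Im v \<noteq> 0\<^sub>v n" using i(1) by auto
  then have "0 < Re a" using pos[OF _ _ re] pos[OF _ _ im] v(1) by auto
  with a show ?thesis by simp
qed

text \<open>If u = M v were nonzero, it would be an eigenvector, so a would be real and M
  self-adjoint. Then the square norm of u is the product of M v with u, hence of v with M u =
  0.\<close>

lemma symmetric_kernel_square:
  fixes a :: complex
  assumes A: "A \<in> carrier_mat n n" and sym: "transpose_mat A = A"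
  defines "M \<equiv> char_matrix (map_mat of_real A) a"
  assumes v: "v \<in> carrier_vec n" and MMv: "M *\<^sub>v (M *\<^sub>v v) = 0\<^sub>v n"
  shows "M *\<^sub>v v = 0\<^sub>v n"
proof (rule ccontr)
  let ?A = "map_mat of_real A :: complex mat"
  assume u0: "M *\<^sub>v v \<noteq> 0\<^sub>v n"
  have Ac: "?A \<in> carrier_mat n n" using A by simp
  have Mc: "M \<in> carrier_mat n n" using Ac by (simp add: M_def)
  have M: "M *\<^sub>v x = ?A *\<^sub>v x + (- a) \<cdot>\<^sub>v x" if "x \<in> carrier_vec n" for x
    using A that unfolding M_def char_matrix_def
    by (intro eq_vecI) (auto simp: add_scalar_prod_distrib[of _ n])
  define u where "u = M *\<^sub>v v"
  have u: "u \<in> carrier_vec n" using Mc v by (auto simp: u_def)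
  have "eigenvector ?A u a"
    using eigenvector_char_matrix[OF Ac, of u a] u u0 MMv by (simp add: M_def[symmetric] u_def)
  then have ev: "?A *\<^sub>v u = a \<cdot>\<^sub>v u" by (simp add: eigenvector_def)
  have real: "cnj a = a" using symmetric_eigenvalue_real[OF A sym u _ ev] u0 by (simp add: u_def)
  have "u \<bullet>c u = (?A *\<^sub>v v + (- a) \<cdot>\<^sub>v v) \<bullet>c u" using M[OF v] by (simp add: u_def)
  also have "\<dots> = (?A *\<^sub>v v) \<bullet>c u + (- a) * (v \<bullet>c u)"
    using Ac v u by (simp add: add_scalar_prod_distrib[of _ n])
  also have "(?A *\<^sub>v v) \<bullet>c u = v \<bullet>c (a \<cdot>\<^sub>v u)" unfolding symmetric_cscalar_prod[OF A sym v u] ev ..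
  also have "\<dots> = a * (v \<bullet>c u)"
    using u v real by (simp add: conjugate_smult_vec conjugate_complex_def)
  finally have "u \<bullet>c u = 0" by simp
  then show False using conjugate_square_eq_0_vec[OF u] u0 by (simp add: u_def)
qed

lemma diagonal_jordan_matrix:
  assumes "\<And>m a. (m, a) \<in> set n_as \<Longrightarrow> m = 1"
  shows "jordan_matrix n_as = mat_diag (length n_as) (\<lambda>i. snd (n_as ! i))"
  using assms
proof (induction n_as)
  case Nil
  then show ?case by (intro eq_matI) (auto simp: jordan_matrix_def mat_diag_def)
next
  case (Cons x xs)
  obtain a where x: "x = (1, a)" using Cons.prems[of "fst x" "snd x"] by (cases x) auto
  have IH: "jordan_matrix xs = mat_diag (length xs) (\<lambda>i. snd (xs ! i))"
    using Cons.prems by (intro Cons.IH) auto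
  have "sum_list (map fst xs) = length xs"
    using arg_cong[OF IH, of dim_row] by (simp add: mat_diag_def)
  then show ?case unfolding x jordan_matrix_Cons IH
    by (intro eq_matI) (auto simp: mat_diag_def four_block_mat_def jordan_block_def nth_Cons' Let_def)
qed

lemma spd_diagonalization:
  assumes A: "A \<in> spd n"
  obtains P Q :: "complex mat" and d :: "nat \<Rightarrow> real"
  where "P \<in> carrier_mat n n" "Q \<in> carrier_mat n n" "P * Q = 1\<^sub>m n" "Q * P = 1\<^sub>m n"
    "\<And>i. i < n \<Longrightarrow> 0 < d i" "map_mat of_real A = P * mat_diag n (\<lambda>i. of_real (d i)) * Q"
proof -
  let ?A = "map_mat of_real A :: complex mat"
  note Ar = spd_carrier[OF A] and sym = spd_transpose[OF A]
  have Ac: "?A \<in> carrier_mat n n" using Ar by simp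
  obtain as where "char_poly ?A = (\<Prod>a\<leftarrow>as. [:- a, 1:])" using char_poly_factorized[OF Ac] by blast
  from jordan_nf_exists[OF Ac this] obtain n_as where jnf: "jordan_nf ?A n_as" ..
  \<comment> \<open>A Jordan block of size at least two would enlarge the kernel of \<open>(A - a)\<^sup>2\<close>.\<close>
  have one: "m = 1" if ma: "(m, a) \<in> set n_as" for m a
  proof -
    let ?M = "char_matrix ?A a"
    have M: "?M \<in> carrier_mat n n" using Ac by simp
    have "?M ^\<^sub>m 2 = ?M * ?M" using M by (simp add: numeral_2_eq_2)
    then have "mat_kernel (?M ^\<^sub>m 2) = mat_kernel ?M"
      using M symmetric_kernel_square[OF Ar sym, of _ a]
      by (auto simp: mat_kernel_def assoc_mult_mat_vec[of _ n n _ n])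
    moreover have "dim_col (?M ^\<^sub>m 2) = dim_col ?M" using M pow_carrier_mat[OF M, of 2] by auto
    ultimately have "kernel_dim (?M ^\<^sub>m 2) = kernel_dim (?M ^\<^sub>m 1)"
      using M by (simp add: kernel_dim_def)
    then have "dim_gen_eigenspace ?A a 2 = dim_gen_eigenspace ?A a 1"
      by (simp add: dim_gen_eigenspace_def)
    \<comment> \<open>A Jordan block of size m for the eigenvalue a contributes
      \<open>min j m\<close> to the dimension of the kernel of (A - a)^j; here j is 2 and 1.\<close>
    then have eq: "(\<Sum>m \<leftarrow> map fst (filter (\<lambda>(m, e). e = a) n_as). min 2 m) =
        (\<Sum>m \<leftarrow> map fst (filter (\<lambda>(m, e). e = a) n_as). min 1 m)"
      unfolding dim_gen_eigenspace[OF jnf] .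
    have "\<forall>m\<in>set ms. min 2 m = min 1 m" 
      if "(\<Sum>m \<leftarrow> ms. min 2 m) = (\<Sum>m \<leftarrow> ms. min 1 m)" for ms :: "nat list"
      using that
    proof (induction ms)
      case (Cons m ms)
      have "(\<Sum>m \<leftarrow> ms. min 1 m) \<le> (\<Sum>m \<leftarrow> ms. min 2 m)" by (intro sum_list_mono) auto
      with Cons show ?case by auto
    qed simp
    from this[OF eq] ma have "min 2 m = min 1 m" by force
    moreover have "m \<noteq> 0" using jnf ma unfolding jordan_nf_def by force
    ultimately show ?thesis by (auto simp: min_def split: if_splits)
  qed
  define d where "d i = snd (n_as ! i)" for i
  have J: "jordan_matrix n_as = mat_diag (length n_as) d"
    unfolding d_def by (rule diagonal_jordan_matrix[OF one])
  from jnf obtain P Q where "similar_mat_wit ?A (mat_diag (length n_as) d) P Q"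
    unfolding jordan_nf_def similar_mat_def J by blast
  note wit = similar_mat_witD2[OF Ac this]
  have len: "length n_as = n" using wit(5) by (auto simp: mat_diag_def)
  note wit = wit[unfolded len]
  \<comment> \<open>Column i of \<open>P\<close> is an eigenvector for \<open>d i\<close>:
    \<open>Q * P = 1\<close> sends it to the i-th unit vector, which the diagonal matrix scales by
    \<open>d i\<close>.\<close>
  have d: "d i = of_real (Re (d i)) \<and> 0 < Re (d i)" if i: "i < n" for i
  proof (rule spd_eigenvalue_pos[OF A])
    show c: "col P i \<in> carrier_vec n" using wit i by auto
    have "Q *\<^sub>v col P i = col (Q * P) i" using wit i by (metis col_mult2)
    then have QP: "Q *\<^sub>v col P i = unit_vec n i" using wit i by simp
    show "col P i \<noteq> 0\<^sub>v n"
    proof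
      assume "col P i = 0\<^sub>v n"
      then have "unit_vec n i = Q *\<^sub>v (0\<^sub>v n)" using QP by simp
      also have "\<dots> = 0\<^sub>v n" using wit by (intro eq_vecI) auto
      finally have "unit_vec n i = (0\<^sub>v n :: complex vec)" .
      from arg_cong[OF this, of "\<lambda>v. v $ i"] show False using i by simp
    qed
    have "?A *\<^sub>v col P i = P *\<^sub>v (mat_diag n d *\<^sub>v (Q *\<^sub>v col P i))"
      unfolding wit(3) using wit c by (simp add: assoc_mult_mat_vec[of _ n n _ n])
    also have "mat_diag n d *\<^sub>v (Q *\<^sub>v col P i) = d i \<cdot>\<^sub>v unit_vec n i"
      unfolding QP using i by (intro eq_vecI) (auto simp: mat_diag_def scalar_prod_def sum.delta if_distrib cong: if_cong)
    also have "P *\<^sub>v (d i \<cdot>\<^sub>v unit_vec n i) = d i \<cdot>\<^sub>v col P i"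
      using wit i by (intro eq_vecI) (auto simp: mult_mat_vec)
    finally show "?A *\<^sub>v col P i = d i \<cdot>\<^sub>v col P i" .
  qed
  have "mat_diag n d = mat_diag n (\<lambda>i. of_real (Re (d i)))"
    using d by (intro eq_matI) (auto simp: mat_diag_def)
  with wit d that[of P Q "\<lambda>i. Re (d i)"] show thesis by simp
qed

section \<open>Functions of a diagonalized matrix and their traces\<close>

lemma conj_mat_diag_mult:
  fixes P Q :: "'a::comm_semiring_1 mat"
  assumes P: "P \<in> carrier_mat n n" and Q: "Q \<in> carrier_mat n n" and QP: "Q * P = 1\<^sub>m n"
  shows "(P * mat_diag n f * Q) * (P * mat_diag n g * Q) = P * mat_diag n (\<lambda>i. f i * g i) * Q"
proof -
  note c = mult_carrier_mat[OF P mat_diag_dim] mult_carrier_mat[OF mat_diag_dim Q]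
  have "(P * mat_diag n f * Q) * (P * mat_diag n g * Q) = (P * mat_diag n f * Q) * (P * (mat_diag n g * Q))"
    using P Q by (simp add: assoc_mult_mat[of _ n n _ n _ n])
  also have "\<dots> = (P * mat_diag n f) * ((Q * P) * (mat_diag n g * Q))"
    using P Q c by (simp add: assoc_mult_mat[of _ n n _ n _ n])
  also have "\<dots> = (P * mat_diag n f) * (mat_diag n g * Q)"
    by (simp only: QP left_mult_one_mat[OF c(2)])
  also have "\<dots> = P * (mat_diag n f * (mat_diag n g * Q))"
    by (rule assoc_mult_mat[OF P mat_diag_dim c(2)])
  also have "mat_diag n f * (mat_diag n g * Q) = mat_diag n f * mat_diag n g * Q"
    by (rule assoc_mult_mat[OF mat_diag_dim mat_diag_dim Q, symmetric])
  finally show ?thesis by (simp only: mat_diag_diag assoc_mult_mat[OF P mat_diag_dim Q])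
qed

lemma conj_mat_diag_shift:
  fixes P Q :: "'a::comm_ring_1 mat"
  assumes P: "P \<in> carrier_mat n n" and Q: "Q \<in> carrier_mat n n" and PQ: "P * Q = 1\<^sub>m n"
  shows "z \<cdot>\<^sub>m 1\<^sub>m n + P * mat_diag n f * Q = P * mat_diag n (\<lambda>i. z + f i) * Q"
proof -
  have D: "mat_diag n (\<lambda>i. z + f i) = z \<cdot>\<^sub>m 1\<^sub>m n + mat_diag n f"
    by (intro eq_matI) (auto simp: mat_diag_def)
  have "P * mat_diag n (\<lambda>i. z + f i) * Q = P * (z \<cdot>\<^sub>m 1\<^sub>m n) * Q + P * mat_diag n f * Q"
    unfolding D using P Q
    by (simp add: mult_add_distrib_mat[of _ n n _ n] add_mult_distrib_mat[of _ n n _ _ n])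
  also have "P * (z \<cdot>\<^sub>m 1\<^sub>m n) * Q = z \<cdot>\<^sub>m (P * Q)"
    using P Q by (simp add: mult_smult_distrib[of _ n n _ n] mult_smult_assoc_mat[of _ n n _ n])
  finally show ?thesis by (simp add: PQ)
qed

text \<open>The trace is linear in the function \<open>f\<close> of the eigenvalues, with
  coefficients that do not depend on \<open>f\<close>. This is what allows the integrand of the norm
  and the trace of B^T A^-1 B to be compared term by term.\<close>

lemma mat_trace_conj_mat_diag:
  fixes P Q :: "'a::comm_semiring_1 mat"
  assumes P: "P \<in> carrier_mat n n" and Q: "Q \<in> carrier_mat n n"
    and X: "X \<in> carrier_mat m n" and Y: "Y \<in> carrier_mat n m"
  shows "mat_trace (X * (P * mat_diag n f * Q) * Y) =
    (\<Sum>i<n. (\<Sum>b<m. (X * P) $$ (b, i) * (Q * Y) $$ (i, b)) * f i)"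
proof -
  have c: "X * P \<in> carrier_mat m n" "Q * Y \<in> carrier_mat n m" using assms by auto
  have "X * (P * mat_diag n f * Q) * Y = X * (P * mat_diag n f) * Q * Y"
    using assms by (simp add: assoc_mult_mat[of X m n _ n Q n])
  also have "X * (P * mat_diag n f) = X * P * mat_diag n f"
    using X P by (simp add: assoc_mult_mat[of X m n P n "mat_diag n f" n])
  also have "X * P * mat_diag n f * Q * Y = X * P * mat_diag n f * (Q * Y)"
    by (rule assoc_mult_mat[OF mult_carrier_mat[OF c(1) mat_diag_dim] Q Y])
  finally have eq: "X * (P * mat_diag n f * Q) * Y = (X * P * mat_diag n f) * (Q * Y)" .
  have "(X * (P * mat_diag n f * Q) * Y) $$ (b, b) = (\<Sum>i<n. (X * P) $$ (b, i) * (Q * Y) $$ (i, b) * f i)"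
    if b: "b < m" for b
    unfolding eq mat_diag_mult_right[OF c(1)] using b Q X Y
    by (simp add: scalar_prod_def atLeast0LessThan mult_ac)
  then have "mat_trace (X * (P * mat_diag n f * Q) * Y) =
      (\<Sum>b<m. \<Sum>i<n. (X * P) $$ (b, i) * (Q * Y) $$ (i, b) * f i)"
    using X by (simp add: mat_trace_def)
  also have "\<dots> = (\<Sum>i<n. \<Sum>b<m. (X * P) $$ (b, i) * (Q * Y) $$ (i, b) * f i)" by (rule sum.swap)
  finally show ?thesis by (simp add: sum_distrib_right)
qed

lemma mat_adjoint_eq_transpose: "mat_adjoint X = transpose_mat (map_mat cnj X)"
  by (intro eq_matI) (auto simp: mat_adjoint_def mat_of_rows_def conjugate_complex_def)

text \<open>Writing the trace as a sum over the columns of \<open>B\<close> serves twice: for its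
  sign, and for splitting the input matrix into the blocks of the single sources.\<close>

lemma mat_trace_congruence:
  assumes U: "U \<in> carrier_mat n n" and B: "B \<in> carrier_mat n m"
  shows "mat_trace (transpose_mat B * U * B) = (\<Sum>b<m. col B b \<bullet> (U *\<^sub>v col B b))"
proof -
  have "(transpose_mat B * U * B) $$ (b, b) = col B b \<bullet> (U *\<^sub>v col B b)" if b: "b < m" for b
  proof -
    have "(transpose_mat B * U * B) $$ (b, b) = col B b \<bullet> col (U * B) b"
      using U B b by (simp add: assoc_mult_mat[of _ m n _ n _ m])
    then show ?thesis using col_mult2[OF U B b] by simp
  qed
  then show ?thesis using B by (simp add: mat_trace_def)
qed

text \<open>Guarantees a nonnegative radicand, so that squaring the norm undoes
  \<open>sqrt\<close>.\<close>

lemma mat_trace_congruence_nonneg: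
  assumes U: "U \<in> spd n" and B: "B \<in> carrier_mat n m"
  shows "0 \<le> mat_trace (transpose_mat B * U * B)"
  unfolding mat_trace_congruence[OF spd_carrier[OF U] B]
proof (rule sum_nonneg)
  fix b assume "b \<in> {..<m}"
  then have c: "col B b \<in> carrier_vec n" using B by auto
  show "0 \<le> col B b \<bullet> (U *\<^sub>v col B b)"
    using spd_pos[OF U c] spd_carrier[OF U] by (cases "col B b = 0\<^sub>v n") auto
qed

text \<open>Both sides are combinations of the eigenvalues with the same coefficients: the frequency
  integral turns 1 / (d^2 + w^2) into pi / d, and dividing by 2 pi leaves half of 1 / d, the
  eigenvalue function of the inverse.\<close>

lemma h2_norm_spd:
  assumes A: "A \<in> spd n" and B: "B \<in> carrier_mat n m"
  shows "h2_norm (- A) B (1\<^sub>m n) = sqrt (1 / 2 * mat_trace (transpose_mat B * the (mat_inverse A) * B))"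
proof -
  interpret cnj: semiring_hom cnj by unfold_locales auto
  let ?c = "map_mat complex_of_real"
  note Ar = spd_carrier[OF A]
  have Ac: "?c A \<in> carrier_mat n n" and Bc: "?c B \<in> carrier_mat n m" using Ar B by auto
  obtain P Q d where P: "P \<in> carrier_mat n n" and Q: "Q \<in> carrier_mat n n"
    and PQ: "P * Q = 1\<^sub>m n" and QP: "Q * P = 1\<^sub>m n" and d: "\<And>i. i < n \<Longrightarrow> 0 < d i"
    and diag: "?c A = P * mat_diag n (\<lambda>i. of_real (d i)) * Q"
    using spd_diagonalization[OF A] by blast
  define S where "S f = P * mat_diag n f * Q" for f
  have S: "S f \<in> carrier_mat n n" for f using P Q by (auto simp: S_def)
  have S_one: "S f = 1\<^sub>m n" if "\<And>i. i < n \<Longrightarrow> f i = 1" for f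
  proof -
    have "mat_diag n f = 1\<^sub>m n" using that by (intro eq_matI) (auto simp: mat_diag_def)
    then show ?thesis using P PQ by (simp add: S_def)
  qed
  have S_mult: "S f * S g = S (\<lambda>i. f i * g i)" for f g
    unfolding S_def by (rule conj_mat_diag_mult[OF P Q QP])
  define N where "N z = z \<cdot>\<^sub>m 1\<^sub>m n + ?c A" for z
  define R where "R z = S (\<lambda>i. 1 / (z + of_real (d i)))" for z
  have Nc: "N z \<in> carrier_mat n n" for z using Ac by (simp add: N_def)
  have Rc: "R z \<in> carrier_mat n n" for z using S by (simp add: R_def)
  have N: "N z = S (\<lambda>i. z + of_real (d i))" for z
    unfolding N_def diag S_def by (rule conj_mat_diag_shift[OF P Q PQ])
  \<comment> \<open>On the imaginary axis the real part of \<open>z + of_real (d i)\<close> is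
    \<open>d i\<close>, which is positive, so no denominator vanishes.\<close>
  have NR: "N z * R z = 1\<^sub>m n" if "Re z = 0" for z
  proof -
    have "z + of_real (d i) \<noteq> 0" if "i < n" for i using d[OF that] \<open>Re z = 0\<close> by (auto simp: complex_eq_iff)
    then show ?thesis unfolding N R_def S_mult by (intro S_one) auto
  qed
  \<comment> \<open>Conjugating and transposing \<open>N z * R z = 1\<close> shows that the adjoint
    of \<open>R z\<close> inverts \<open>N (cnj z)\<close>, because A is real and symmetric.
    \<open>R (cnj z)\<close> inverts it too, so the two agree.\<close>
  have adj: "transpose_mat (map_mat cnj (R z)) = R (cnj z)" if z: "Re z = 0" for z
  proof -
    let ?X = "map_mat cnj (R z)"
    have X: "?X \<in> carrier_mat n n" using Rc by simp
    have "map_mat cnj (N z) * ?X = map_mat cnj (1\<^sub>m n)"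
      using cnj.mat_hom_mult[OF Nc Rc, of z z] NR[OF z] by simp
    moreover have "map_mat cnj (N z) = N (cnj z)" using Ar by (intro eq_matI) (auto simp: N_def)
    moreover have "map_mat cnj (1\<^sub>m n) = (1\<^sub>m n :: complex mat)" by (intro eq_matI) auto
    ultimately have NX: "N (cnj z) * ?X = 1\<^sub>m n" by simp
    have "A $$ (j, i) = A $$ (i, j)" if "i < n" "j < n" for i j
      using arg_cong[OF spd_transpose[OF A], of "\<lambda>M. M $$ (i, j)"] Ar that by simp
    then have NT: "transpose_mat (N (cnj z)) = N (cnj z)"
      using Ar by (intro eq_matI) (auto simp: N_def)
    have "transpose_mat ?X * N (cnj z) = 1\<^sub>m n"
      using arg_cong[OF NX, of transpose_mat] unfolding transpose_mult[OF Nc X] NT by simp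
    then have "N (cnj z) * transpose_mat ?X = 1\<^sub>m n"
      by (rule mat_mult_left_right_inverse[rotated 2]) (use X Nc in auto)
    then have "mat_inverse (N (cnj z)) = Some (transpose_mat ?X)"
      using X by (intro mat_inverse_eqI[OF Nc]) auto
    moreover have "mat_inverse (N (cnj z)) = Some (R (cnj z))"
      using z by (intro mat_inverse_eqI[OF Nc Rc] NR) auto
    ultimately show ?thesis by simp
  qed
  define c where "c i = (\<Sum>b<m. (transpose_mat (?c B) * P) $$ (b, i) * (Q * ?c B) $$ (i, b))" for i
  have trace: "mat_trace (transpose_mat (?c B) * S f * ?c B) = (\<Sum>i<n. c i * f i)" for f
    unfolding S_def c_def using Bc by (intro mat_trace_conj_mat_diag[OF P Q]) auto
  have integrand: "Re (mat_trace (mat_adjoint (transfer_function (- A) B (1\<^sub>m n) (\<i> * of_real w)) *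
      transfer_function (- A) B (1\<^sub>m n) (\<i> * of_real w))) = (\<Sum>i<n. Re (c i) * (1 / ((d i)\<^sup>2 + w\<^sup>2)))" for w
  proof -
    let ?z = "\<i> * complex_of_real w"
    have "?z \<cdot>\<^sub>m 1\<^sub>m (dim_row (- A)) - ?c (- A) = N ?z"
      using Ar by (intro eq_matI) (auto simp: N_def)
    moreover have "mat_inverse (N ?z) = Some (R ?z)"
      by (rule mat_inverse_eqI[OF Nc Rc NR]) simp
    moreover have "?c (1\<^sub>m n) * R ?z = R ?z"
      using Rc[of ?z] by (simp add: of_real_hom.mat_hom_one)
    ultimately have tf: "transfer_function (- A) B (1\<^sub>m n) ?z = R ?z * ?c B"
      by (simp add: transfer_function_def)
    have "map_mat cnj (?c B) = ?c B" by (intro eq_matI) auto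
    then have "mat_adjoint (R ?z * ?c B) = transpose_mat (?c B) * R (cnj ?z)"
      unfolding mat_adjoint_eq_transpose cnj.mat_hom_mult[OF Rc Bc]
      using transpose_mult[of "map_mat cnj (R ?z)" n n "?c B" m] Rc Bc adj[of ?z] by simp
    then have "mat_adjoint (R ?z * ?c B) * (R ?z * ?c B) =
        transpose_mat (?c B) * (R (cnj ?z) * R ?z) * ?c B"
      using Rc[of ?z] Rc[of "cnj ?z"] Bc
      by (simp add: assoc_mult_mat[of _ m n _ n _ m] assoc_mult_mat[of _ n n _ n _ m])
    also have "R (cnj ?z) * R ?z = S (\<lambda>i. of_real (1 / ((d i)\<^sup>2 + w\<^sup>2)))"
    proof -
      have "1 / (cnj ?z + of_real (d i)) * (1 / (?z + of_real (d i))) = of_real (1 / ((d i)\<^sup>2 + w\<^sup>2))" for i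
        by (simp add: algebra_simps power2_eq_square)
      then show ?thesis unfolding R_def S_mult by presburger
    qed
    finally show ?thesis unfolding tf by (simp only: trace Re_sum) simp
  qed
  obtain U where U: "mat_inverse A = Some U" "U \<in> spd n" "A * U = 1\<^sub>m n"
    using spd_inverse[OF A] by blast
  note Ur = spd_carrier[OF U(2)]
  \<comment> \<open>The real inverse read as a complex matrix and the function 1 / d of the diagonal
    form both invert \<open>?c A\<close>, hence coincide.\<close>
  have "mat_inverse (?c A) = Some (?c U)"
    using U Ar Ur by (intro mat_inverse_eqI[OF Ac]) 
      (auto simp: of_real_hom.mat_hom_mult[symmetric] of_real_hom.mat_hom_one)
  moreover have "mat_inverse (?c A) = Some (S (\<lambda>i. of_real (1 / d i)))"
    using d by (intro mat_inverse_eqI[OF Ac S]) (auto simp: diag S_def[symmetric] S_mult intro!: S_one dest: d)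
  ultimately have Uc: "?c U = S (\<lambda>i. of_real (1 / d i))" by simp
  have "complex_of_real (mat_trace (transpose_mat B * U * B)) = mat_trace (?c (transpose_mat B * U * B))"
    using B by (simp add: mat_trace_def)
  also have "?c (transpose_mat B * U * B) = transpose_mat (?c B) * ?c U * ?c B"
    using B Ur by (simp add: of_real_hom.mat_hom_mult[of _ m n _ m] of_real_hom.mat_hom_mult[of _ m n _ n] of_real_hom.mat_hom_mult[of _ n n _ m] map_mat_transpose)
  finally have "mat_trace (transpose_mat B * U * B) = Re (\<Sum>i<n. c i * of_real (1 / d i))"
    unfolding Uc trace by (metis Re_complex_of_real)
  then have tr: "mat_trace (transpose_mat B * U * B) = (\<Sum>i<n. Re (c i) / d i)" by simp
  have "(LINT w|lborel. (\<Sum>i<n. Re (c i) * (1 / ((d i)\<^sup>2 + w\<^sup>2)))) =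
      (\<Sum>i<n. (LINT w|lborel. Re (c i) * (1 / ((d i)\<^sup>2 + w\<^sup>2))))"
    by (intro Bochner_Integration.integral_sum integrable_mult_right integral_inverse_square_plus d) auto
  also have "\<dots> = (\<Sum>i<n. Re (c i) * (pi / d i))"
    by (intro sum.cong refl) (simp only: integral_mult_right_zero integral_inverse_square_plus(2)[OF d] lessThan_iff)
  also have "\<dots> = pi * (\<Sum>i<n. Re (c i) / d i)" by (simp add: sum_distrib_left mult_ac)
  finally show ?thesis unfolding h2_norm_def integrand U(1) tr[symmetric] by (simp add: tr)
qed

section \<open>The Dirichlet Laplacian\<close>

lemma bij_betw_rank:
  fixes S :: "nat set"
  assumes fin: "finite S"
  shows "bij_betw (\<lambda>i. card {j \<in> S. j < i}) S {..<card S}"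
proof -
  let ?f = "\<lambda>i. card {j \<in> S. j < i}"
  have "?f i < ?f i'" if "i \<in> S" "i < i'" for i i'
  proof (rule psubset_card_mono)
    have "i \<in> {j \<in> S. j < i'}" "i \<notin> {j \<in> S. j < i}" using that by auto
    moreover have "{j \<in> S. j < i} \<subseteq> {j \<in> S. j < i'}" using that by auto
    ultimately show "{j \<in> S. j < i} \<subset> {j \<in> S. j < i'}" by blast
  qed (simp add: fin)
  note less = this
  have inj: "inj_on ?f S"
  proof (rule inj_onI)
    fix i i' assume "i \<in> S" "i' \<in> S" "?f i = ?f i'"
    with less[of i i'] less[of i' i] show "i = i'" by (cases i i' rule: linorder_cases) simp_all
  qed
  have "?f i < card S" if "i \<in> S" for i
    using that fin by (intro psubset_card_mono) auto
  then have "?f ` S \<subseteq> {..<card S}" by auto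
  then have "?f ` S = {..<card S}" using card_image[OF inj] by (intro card_subset_eq) auto
  with inj show ?thesis by (simp add: bij_betw_def)
qed

lemma mult_mat_vec_sum:
  assumes "finite I" "\<And>e. e \<in> I \<Longrightarrow> M e \<in> carrier_mat m n" "x \<in> carrier_vec n" "r < m"
  shows "(\<Sum>c<n. (\<Sum>e\<in>I. M e $$ (r, c)) * x $ c) = (\<Sum>e\<in>I. (M e *\<^sub>v x) $ r)"
proof -
  have "(\<Sum>c<n. (\<Sum>e\<in>I. M e $$ (r, c)) * x $ c) = (\<Sum>e\<in>I. \<Sum>c<n. M e $$ (r, c) * x $ c)"
    by (simp add: sum_distrib_right sum.swap[of _ "{..<n}"])
  also have "\<dots> = (\<Sum>e\<in>I. (M e *\<^sub>v x) $ r)"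
  proof (rule sum.cong)
    fix e assume "e \<in> I"
    note M = carrier_matD[OF assms(2)[OF \<open>e \<in> I\<close>]]
    show "(\<Sum>c<n. M e $$ (r, c) * x $ c) = (M e *\<^sub>v x) $ r"
      using assms(3,4) M by (auto simp: scalar_prod_def atLeast0LessThan intro!: sum.cong)
  qed simp
  finally show ?thesis .
qed

lemma scalar_prod_eq_sum: "y \<in> carrier_vec m \<Longrightarrow> x \<bullet> y = (\<Sum>r<m. x $ r * y $ r)"
  by (simp add: scalar_prod_def atLeast0LessThan)

text \<open>The net current leaving \<open>v\<close> when the weights are conductances and
  \<open>X\<close> are the potentials. It is taken one component \<open>p\<close> at a time, so that
  the sum over the neighbours is a sum of reals.\<close>

definition outflow :: "('v set \<Rightarrow> real mat) \<Rightarrow> 'v set set \<Rightarrow> ('v \<Rightarrow> real vec) \<Rightarrow> 'v \<Rightarrow> nat \<Rightarrow> real" where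
  "outflow w E X v p = (\<Sum>u | {u, v} \<in> E. (w {u, v} *\<^sub>v (X v - X u)) $ p)"

definition block :: "nat \<Rightarrow> lf_graph \<Rightarrow> real vec \<Rightarrow> nat \<Rightarrow> real vec" where
  "block k G x v = vec k (\<lambda>p. x $ (follower_index G v * k + p))"

lemma block_carrier [simp]: "block k G x v \<in> carrier_vec k"
  by (simp add: block_def)

locale leader_follower_graph =
  fixes k :: nat and G :: lf_graph
  assumes lf: "leader_follower k G"
begin

abbreviation "n \<equiv> state_dim k G"
abbreviation "A \<equiv> dirichlet_laplacian k G"

section \<open>Edges, leaders and source nodes\<close>

lemma edge_nodes:
  assumes "e \<in> edges G" shows "\<exists>u v. e = {u, v} \<and> u \<in> nodes G \<and> v \<in> nodes G \<and> u \<noteq> v"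
proof -
  have "edges G \<subseteq> {{u, v} | u v. u \<in> nodes G \<and> v \<in> nodes G \<and> u \<noteq> v}"
    using lf[unfolded leader_follower_def simple_graph_def] by (elim conjE)
  with assms show ?thesis by blast
qed

lemma finite_nodes: "finite (nodes G)"
  using lf[unfolded leader_follower_def simple_graph_def] by (elim conjE)

lemma weight_spd:
  assumes "e \<in> edges G" shows "weight G e \<in> spd k"
proof -
  have "\<forall>e\<in>edges G. weight G e \<in> spd k" using lf[unfolded leader_follower_def] by (elim conjE)
  with assms show ?thesis by simp
qed

lemma leaders_nodes: "leaders G \<subset> nodes G"
  using lf[unfolded leader_follower_def] by (elim conjE)

lemma leaders_nonempty: "leaders G \<noteq> {}"
  using lf[unfolded leader_follower_def] by (elim conjE)

lemma connected:
  assumes "u \<in> nodes G" "v \<in> nodes G" shows "(u, v) \<in> {(a, b). {a, b} \<in> edges G}\<^sup>*"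
proof -
  have "\<forall>u\<in>nodes G. \<forall>v\<in>nodes G. (u, v) \<in> {(a, b). {a, b} \<in> edges G}\<^sup>*"
    using lf[unfolded leader_follower_def connected_graph_def] by (elim conjE)
  with assms show ?thesis by simp
qed

lemma leader_unique:
  assumes "r \<in> leaders G" "r' \<in> leaders G" "{r, i} \<in> edges G" "{r', i} \<in> edges G" shows "r = r'"
proof -
  have "\<forall>r\<in>leaders G. \<forall>r'\<in>leaders G. \<forall>i. {r, i} \<in> edges G \<and> {r', i} \<in> edges G \<longrightarrow> r = r'"
    using lf[unfolded leader_follower_def] by (elim conjE)
  with assms show ?thesis by blast
qed

lemma leader_edge:
  assumes "r \<in> leaders G"
  obtains i where "i \<in> followers G" "{r, i} \<in> edges G" "\<And>v. {r, v} \<in> edges G \<Longrightarrow> v = i"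
proof -
  have "\<forall>r\<in>leaders G. \<exists>i\<in>followers G. {e \<in> edges G. r \<in> e} = {{r, i}} \<and> weight G {r, i} = 1\<^sub>m k"
    using lf[unfolded leader_follower_def] by (elim conjE)
  from bspec[OF this assms] obtain i where i: "i \<in> followers G" "{e \<in> edges G. r \<in> e} = {{r, i}}"
    by (elim bexE conjE)
  have e: "e \<in> edges G \<and> r \<in> e \<longleftrightarrow> e = {r, i}" for e
    using arg_cong[OF i(2), of "\<lambda>E. e \<in> E"] by (simp only: mem_Collect_eq singleton_iff)
  have v: "v = i" if "{r, v} \<in> edges G" for v
  proof -
    have "{r, v} = {r, i}" by (rule iffD1[OF e]) (simp add: that)
    then show ?thesis by (metis doubleton_eq_iff)
  qed
  have "{r, i} \<in> edges G" using e[of "{r, i}"] by simp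
  then show thesis by (rule that[OF i(1) _ v])
qed

lemma leader_neighbour:
  assumes "r \<in> leaders G" "{r, v} \<in> edges G"
  shows "v \<in> sources G"
proof -
  obtain i where "i \<in> followers G" "\<And>v. {r, v} \<in> edges G \<Longrightarrow> v = i" using leader_edge[OF assms(1)] by metis
  with assms(2) have "v \<in> followers G" by simp
  with assms show ?thesis unfolding sources_def by blast
qed

lemma finite_followers: "finite (followers G)"
  using finite_nodes by (simp add: followers_def)

lemma sources_followers: "sources G \<subseteq> followers G"
  by (auto simp: sources_def)

lemma finite_sources: "finite (sources G)"
  using sources_followers finite_followers by (rule finite_subset)

lemma finite_edges: "finite (edges G)"
proof (rule finite_subset)
  show "edges G \<subseteq> Pow (nodes G)" using edge_nodes by blast
qed (simp add: finite_nodes)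

lemma leader_of: "leader_of G i \<in> leaders G" "{leader_of G i, i} \<in> edges G" if i: "i \<in> sources G"
proof -
  obtain r where r: "r \<in> leaders G" "{r, i} \<in> edges G" using i by (auto simp: sources_def)
  then have "\<exists>!r. r \<in> leaders G \<and> {r, i} \<in> edges G" using leader_unique by blast
  from theI'[OF this] show "leader_of G i \<in> leaders G" "{leader_of G i, i} \<in> edges G"
    by (simp_all add: leader_of_def)
qed

lemma leader_of_eq: "r \<in> leaders G \<Longrightarrow> {r, i} \<in> edges G \<Longrightarrow> leader_of G i = r"
  using leader_neighbour[of r i] leader_of[of i] leader_unique by blast

text \<open>Injective because a leader has a single edge, well defined because distinct leaders are
  attached to distinct followers. The cost, a sum over sources, can thus be expressed through the
  number of leaders.\<close>

lemma bij_betw_sources_leaders: "bij_betw (leader_of G) (sources G) (leaders G)"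
proof (rule bij_betw_imageI)
  show "inj_on (leader_of G) (sources G)"
  proof (rule inj_onI)
    fix i j assume ij: "i \<in> sources G" "j \<in> sources G" "leader_of G i = leader_of G j"
    obtain v where "\<And>u. {leader_of G i, u} \<in> edges G \<Longrightarrow> u = v"
      using leader_edge[OF leader_of(1)[OF ij(1)]] by metis
    then show "i = j" using leader_of(2)[OF ij(1)] leader_of(2)[OF ij(2)] ij(3) by metis
  qed
  show "leader_of G ` sources G = leaders G"
  proof
    show "leader_of G ` sources G \<subseteq> leaders G" using leader_of by blast
    show "leaders G \<subseteq> leader_of G ` sources G"
    proof
      fix r assume r: "r \<in> leaders G"
      obtain i where e: "{r, i} \<in> edges G" using leader_edge[OF r] by metis
      then show "r \<in> leader_of G ` sources G"
        using leader_of_eq[OF r e] leader_neighbour[OF r e] by blast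
    qed
  qed
qed

section \<open>Block indexing of state vectors\<close>

lemma bij_betw_follower_index: "bij_betw (follower_index G) (followers G) {..<card (followers G)}"
  using bij_betw_rank[OF finite_followers] by (simp add: follower_index_def[abs_def])

lemma follower_index_eq_iff:
  "u \<in> followers G \<Longrightarrow> v \<in> followers G \<Longrightarrow> follower_index G u = follower_index G v \<longleftrightarrow> u = v"
  using bij_betw_follower_index by (auto simp: bij_betw_def inj_on_def)

lemma row_index_less:
  assumes "v \<in> followers G" "p < k"
  shows "follower_index G v * k + p < n"
proof -
  have "follower_index G v < card (followers G)"
    using bij_betw_follower_index assms(1) by (auto simp: bij_betw_def)
  then have "Suc (follower_index G v) * k \<le> card (followers G) * k" by (intro mult_le_mono1) simp
  with assms(2) show ?thesis by (simp add: state_dim_def)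
qed

lemma row_index_eq_iff:
  assumes "u \<in> followers G" "v \<in> followers G" "p < k" "q < k"
  shows "follower_index G u * k + p = follower_index G v * k + q \<longleftrightarrow> u = v \<and> p = q"
proof
  assume eq: "follower_index G u * k + p = follower_index G v * k + q"
  have "(follower_index G u * k + p) div k = (follower_index G v * k + q) div k" by (simp only: eq)
  moreover have "(follower_index G u * k + p) mod k = (follower_index G v * k + q) mod k" by (simp only: eq)
  ultimately show "u = v \<and> p = q" using assms follower_index_eq_iff by simp
qed simp

text \<open>Division with remainder by k. It allows equations between state vectors to be checked
  one follower and one component at a time.\<close>

lemma row_index_cases:
  assumes "r < n"
  obtains v p where "v \<in> followers G" "p < k" "r = follower_index G v * k + p"
proof -
  have k: "0 < k" using assms by (cases k) (auto simp: state_dim_def)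
  have "r div k < card (followers G)" using assms by (simp add: state_dim_def less_mult_imp_div_less)
  then obtain v where v: "v \<in> followers G" "follower_index G v = r div k"
    using bij_betw_follower_index unfolding bij_betw_def by (metis imageE lessThan_iff)
  then show thesis using k by (intro that[of v "r mod k"]) auto
qed

lemma vec_eq_blockI:
  assumes "x \<in> carrier_vec n" "y \<in> carrier_vec n" "\<And>v. v \<in> followers G \<Longrightarrow> block k G x v = block k G y v"
  shows "x = y"
proof (rule eq_vecI)
  fix r assume "r < dim_vec y"
  with assms have "r < n" by simp
  then obtain v p where "v \<in> followers G" "p < k" "r = follower_index G v * k + p"
    by (rule row_index_cases)
  with arg_cong[OF assms(3), of v "\<lambda>b. b $ p"] show "x $ r = y $ r" by (simp add: block_def)
qed (use assms in auto)

lemma block_unit_carrier [simp]: "block_unit k G v \<in> carrier_mat n k"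
  by (simp add: block_unit_def)

lemma dim_block_unit [simp]: "dim_row (block_unit k G v) = n" "dim_col (block_unit k G v) = k"
  by (simp_all add: block_unit_def)

lemma transpose_block_unit_mult:
  assumes v: "v \<in> followers G" and x: "x \<in> carrier_vec n"
  shows "transpose_mat (block_unit k G v) *\<^sub>v x = block k G x v"
proof (rule eq_vecI)
  fix p assume "p < dim_vec (block k G x v)"
  then have p: "p < k" by (simp add: block_def)
  have "(transpose_mat (block_unit k G v) *\<^sub>v x) $ p =
      (\<Sum>r<n. (if r = follower_index G v * k + p then 1 else 0) * x $ r)"
    using p x by (auto simp: block_unit_def scalar_prod_def atLeast0LessThan intro!: sum.cong)
  also have "\<dots> = (\<Sum>r<n. if r = follower_index G v * k + p then x $ r else 0)"
    by (intro sum.cong) auto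
  also have "\<dots> = x $ (follower_index G v * k + p)"
    using row_index_less[OF v p] by simp
  finally show "(transpose_mat (block_unit k G v) *\<^sub>v x) $ p = block k G x v $ p"
    using p by (simp add: block_def)
qed (simp add: block_def block_unit_def)

lemma block_unit_mult:
  assumes v: "v \<in> followers G" and u: "u \<in> followers G" and p: "p < k" and y: "y \<in> carrier_vec k"
  shows "(block_unit k G v *\<^sub>v y) $ (follower_index G u * k + p) = (if u = v then y $ p else 0)"
proof -
  have "(block_unit k G v *\<^sub>v y) $ (follower_index G u * k + p) =
      (\<Sum>c<k. (if follower_index G u * k + p = follower_index G v * k + c then 1 else 0) * y $ c)"
    using row_index_less[OF u p] y by (auto simp: block_unit_def scalar_prod_def atLeast0LessThan intro!: sum.cong)
  also have "\<dots> = (\<Sum>c<k. if c = p then (if u = v then y $ p else 0) else 0)"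
    using assms by (intro sum.cong) (auto simp: row_index_eq_iff)
  finally show ?thesis using p by simp
qed

section \<open>The Laplacian as an operator on potentials\<close>

abbreviation "follower_edges \<equiv> {e \<in> edges G. e \<subseteq> followers G}"
abbreviation "incidence e \<equiv> block_unit k G (Min e) - block_unit k G (Max e)"
abbreviation "edge_term e \<equiv> incidence e * weight G e * transpose_mat (incidence e)"
abbreviation "source_term i \<equiv> block_unit k G i * weight G {leader_of G i, i} * transpose_mat (block_unit k G i)"

lemma follower_edgeE:
  assumes "e \<in> follower_edges"
  obtains u v where "e = {u, v}" "u < v" "Min e = u" "Max e = v" "u \<in> followers G" "v \<in> followers G"
proof -
  obtain u v where uv: "e = {u, v}" "u \<noteq> v" using assms edge_nodes by blast
  then consider "u < v" | "v < u" by linarith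
  then show thesis
  proof cases
    case 1 with uv assms show thesis by (intro that[of u v]) auto
  next
    case 2 with uv assms show thesis by (intro that[of v u]) auto
  qed
qed

lemma Min_Max_followers:
  assumes "e \<in> follower_edges" shows "Min e \<in> followers G" "Max e \<in> followers G"
proof -
  obtain u v where "Min e = u" "Max e = v" "u \<in> followers G" "v \<in> followers G"
    using assms by (rule follower_edgeE)
  then show "Min e \<in> followers G" "Max e \<in> followers G" by simp_all
qed

lemma incidence_carrier [simp]: "incidence e \<in> carrier_mat n k"
  by (intro minus_carrier_mat) simp

lemma edge_term_carrier: "e \<in> edges G \<Longrightarrow> edge_term e \<in> carrier_mat n n"
  using spd_carrier[OF weight_spd] incidence_carrier[of e]
  by (metis mult_carrier_mat transpose_carrier_mat)

lemma source_term_carrier: "i \<in> sources G \<Longrightarrow> source_term i \<in> carrier_mat n n"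
  using spd_carrier[OF weight_spd[OF leader_of(2)]] block_unit_carrier[of i]
  by (metis mult_carrier_mat transpose_carrier_mat)

lemma laplacian_carrier [simp]: "A \<in> carrier_mat n n"
  by (simp add: dirichlet_laplacian_def)

lemma laplacian_mult:
  assumes x: "x \<in> carrier_vec n" and r: "r < n"
  shows "(A *\<^sub>v x) $ r = (\<Sum>e\<in>follower_edges. (edge_term e *\<^sub>v x) $ r) + (\<Sum>i\<in>sources G. (source_term i *\<^sub>v x) $ r)"
proof -
  have "(A *\<^sub>v x) $ r = (\<Sum>c<n. (\<Sum>e\<in>follower_edges. edge_term e $$ (r, c)) * x $ c) +
      (\<Sum>c<n. (\<Sum>i\<in>sources G. source_term i $$ (r, c)) * x $ c)"
    using x r by (simp add: dirichlet_laplacian_def scalar_prod_def atLeast0LessThan distrib_right sum.distrib)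
  moreover have "finite follower_edges" using finite_edges by simp
  ultimately show ?thesis
    using mult_mat_vec_sum[of follower_edges edge_term n n x r] mult_mat_vec_sum[of "sources G" source_term n n x r]
      finite_sources x r edge_term_carrier source_term_carrier by simp
qed

lemma transpose_incidence_mult:
  assumes e: "e \<in> follower_edges" and x: "x \<in> carrier_vec n"
  shows "transpose_mat (incidence e) *\<^sub>v x = block k G x (Min e) - block k G x (Max e)"
proof -
  have "transpose_mat (incidence e) = transpose_mat (block_unit k G (Min e)) - transpose_mat (block_unit k G (Max e))"
    by (simp add: transpose_minus[of _ n k])
  then show ?thesis
    using x Min_Max_followers[OF e]
    by (simp add: minus_mult_distrib_mat_vec[of _ k n] transpose_block_unit_mult)
qed

lemma edge_term_mult:
  assumes e: "e \<in> follower_edges" and x: "x \<in> carrier_vec n"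
  shows "edge_term e *\<^sub>v x = incidence e *\<^sub>v (weight G e *\<^sub>v (block k G x (Min e) - block k G x (Max e)))"
proof -
  have W: "weight G e \<in> carrier_mat k k" using e spd_carrier[OF weight_spd] by blast
  have "edge_term e *\<^sub>v x = incidence e *\<^sub>v (weight G e *\<^sub>v (transpose_mat (incidence e) *\<^sub>v x))"
    using assoc_mult_mat_vec[OF mult_carrier_mat[OF incidence_carrier W] transpose_carrier_mat[THEN iffD2, OF incidence_carrier] x]
      assoc_mult_mat_vec[OF incidence_carrier W, of "transpose_mat (incidence e) *\<^sub>v x"]
      mult_mat_vec_carrier[OF transpose_carrier_mat[THEN iffD2, OF incidence_carrier] x]
    by simp
  then show ?thesis by (simp only: transpose_incidence_mult[OF e x])
qed

lemma source_term_mult: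
  assumes i: "i \<in> sources G" and x: "x \<in> carrier_vec n"
  shows "source_term i *\<^sub>v x = block_unit k G i *\<^sub>v (weight G {leader_of G i, i} *\<^sub>v block k G x i)"
proof -
  have W: "weight G {leader_of G i, i} \<in> carrier_mat k k" using spd_carrier[OF weight_spd[OF leader_of(2)[OF i]]] .
  have "source_term i *\<^sub>v x = block_unit k G i *\<^sub>v (weight G {leader_of G i, i} *\<^sub>v (transpose_mat (block_unit k G i) *\<^sub>v x))"
    using assoc_mult_mat_vec[OF mult_carrier_mat[OF block_unit_carrier W] transpose_carrier_mat[THEN iffD2, OF block_unit_carrier] x]
      assoc_mult_mat_vec[OF block_unit_carrier W, of "transpose_mat (block_unit k G i) *\<^sub>v x"]
      mult_mat_vec_carrier[OF transpose_carrier_mat[THEN iffD2, OF block_unit_carrier] x]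
    by simp
  then show ?thesis using i sources_followers x by (auto simp: transpose_block_unit_mult)
qed

text \<open>Rewrites the sum over edges oriented by \<open>Min\<close> and \<open>Max\<close> as a
  sum over the neighbours of \<open>v\<close>. In this form A x is the outflow for potentials that
  vanish at the leaders: the source term is the current towards a leader at potential zero.\<close>

lemma laplacian_action:
  assumes x: "x \<in> carrier_vec n" and v: "v \<in> followers G" and p: "p < k"
  defines "z \<equiv> block k G x"
  shows "(A *\<^sub>v x) $ (follower_index G v * k + p) =
    (\<Sum>u | u \<in> followers G \<and> {u, v} \<in> edges G. (weight G {u, v} *\<^sub>v (z v - z u)) $ p) +
    (if v \<in> sources G then (weight G {leader_of G v, v} *\<^sub>v z v) $ p else 0)"
proof -
  let ?r = "follower_index G v * k + p"
  have z [simp]: "z u \<in> carrier_vec k" for u by (simp add: z_def)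
  have W: "weight G e \<in> carrier_mat k k" if "e \<in> edges G" for e using spd_carrier[OF weight_spd[OF that]] .
  let ?t = "\<lambda>e. (edge_term e *\<^sub>v x) $ ?r"
  let ?N = "{u. u \<in> followers G \<and> {u, v} \<in> edges G}"
  have t: "?t e = (if v = Min e then (weight G e *\<^sub>v (z (Min e) - z (Max e))) $ p else 0) -
      (if v = Max e then (weight G e *\<^sub>v (z (Min e) - z (Max e))) $ p else 0)"
    if e: "e \<in> follower_edges" for e
  proof -
    have y: "weight G e *\<^sub>v (z (Min e) - z (Max e)) \<in> carrier_vec k"
      using e by (intro mult_mat_vec_carrier[OF W]) auto
    have "?t e = (incidence e *\<^sub>v (weight G e *\<^sub>v (z (Min e) - z (Max e)))) $ ?r"
      by (simp only: edge_term_mult[OF e x] z_def)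
    also have "\<dots> = (block_unit k G (Min e) *\<^sub>v (weight G e *\<^sub>v (z (Min e) - z (Max e)))) $ ?r -
        (block_unit k G (Max e) *\<^sub>v (weight G e *\<^sub>v (z (Min e) - z (Max e)))) $ ?r"
      using y row_index_less[OF v p]
      by (simp add: minus_mult_distrib_mat_vec[of _ n k])
    finally show ?thesis by (simp only: block_unit_mult[OF _ v p y] Min_Max_followers[OF e])
  qed
  \<comment> \<open>An edge contributes to the row of \<open>v\<close> only if \<open>v\<close> is
    one of its endpoints, and then the other endpoint determines it.\<close>
  have "(\<Sum>e\<in>follower_edges. ?t e) = (\<Sum>e\<in>(\<lambda>u. {u, v}) ` ?N. ?t e)"
  proof (rule sum.mono_neutral_right)
    show "(\<lambda>u. {u, v}) ` ?N \<subseteq> follower_edges" using v by auto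
    show "\<forall>e\<in>follower_edges - (\<lambda>u. {u, v}) ` ?N. ?t e = 0"
    proof
      fix e assume e: "e \<in> follower_edges - (\<lambda>u. {u, v}) ` ?N"
      then have "e \<in> follower_edges" by blast
      then obtain a b where ab: "e = {a, b}" "Min e = a" "Max e = b" "a \<in> followers G" "b \<in> followers G"
        by (rule follower_edgeE)
      then have "v \<noteq> a" "v \<noteq> b" using e by (auto simp: insert_commute)
      then show "?t e = 0" using t[of e] e ab by simp
    qed
  qed (simp add: finite_edges)
  also have "\<dots> = (\<Sum>u\<in>?N. ?t {u, v})"
    by (subst sum.reindex) (auto simp: inj_on_def doubleton_eq_iff)
  also have "\<dots> = (\<Sum>u\<in>?N. (weight G {u, v} *\<^sub>v (z v - z u)) $ p)"
  proof (rule sum.cong)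
    fix u assume u: "u \<in> ?N"
    then have e: "{u, v} \<in> follower_edges" using v by auto
    then have "u \<noteq> v" using edge_nodes[of "{u, v}"] by (auto simp: doubleton_eq_iff)
    then consider "u < v" | "v < u" by linarith
    then show "?t {u, v} = (weight G {u, v} *\<^sub>v (z v - z u)) $ p"
    proof cases
      case 1
      \<comment> \<open>When \<open>v\<close> is the larger endpoint, its incidence sign and the
        potential difference are both reversed, and the two signs cancel.\<close>
      have "z v - z u = (-1) \<cdot>\<^sub>v (z u - z v)" by (intro eq_vecI) (auto simp: z_def block_def)
      then show ?thesis using 1 t[OF e] W[of "{u, v}"] e p by (simp add: mult_mat_vec[of _ k k])
    next
      case 2 then show ?thesis using t[OF e] by simp
    qed
  qed simp
  finally have 1: "(\<Sum>e\<in>follower_edges. ?t e) = (\<Sum>u\<in>?N. (weight G {u, v} *\<^sub>v (z v - z u)) $ p)" .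
  have "(source_term i *\<^sub>v x) $ ?r = (if i = v then (weight G {leader_of G v, v} *\<^sub>v z v) $ p else 0)"
    if i: "i \<in> sources G" for i
  proof -
    have "weight G {leader_of G i, i} *\<^sub>v z i \<in> carrier_vec k"
      by (rule mult_mat_vec_carrier[OF W[OF leader_of(2)[OF i]] z])
    then show ?thesis
      unfolding source_term_mult[OF i x] z_def[symmetric]
      using block_unit_mult[of i v p "weight G {leader_of G i, i} *\<^sub>v z i"] i v p sources_followers by auto
  qed
  then have "(\<Sum>i\<in>sources G. (source_term i *\<^sub>v x) $ ?r) =
      (if v \<in> sources G then (weight G {leader_of G v, v} *\<^sub>v z v) $ p else 0)"
    using finite_sources by (simp add: sum.delta' cong: sum.cong)
  with 1 laplacian_mult[OF x row_index_less[OF v p]] show ?thesis by simp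
qed

section \<open>Positive definiteness of the Laplacian\<close>

lemma laplacian_symmetric: "transpose_mat A = A"
proof -
  have sym: "transpose_mat (U * W * transpose_mat U) = U * W * transpose_mat U"
    if U: "U \<in> carrier_mat n k" and W: "W \<in> spd k" for U W
  proof -
    note Wc = spd_carrier[OF W]
    have "transpose_mat (U * W * transpose_mat U) = U * (W * transpose_mat U)"
      using transpose_mult[OF mult_carrier_mat[OF U Wc] transpose_carrier_mat[THEN iffD2, OF U]]
        transpose_mult[OF U Wc] spd_transpose[OF W] by simp
    then show ?thesis using U Wc by (simp add: assoc_mult_mat[of _ n k _ k _ n])
  qed
  have entry: "M $$ (j, i) = M $$ (i, j)" if "transpose_mat M = M" "M \<in> carrier_mat n n" "i < n" "j < n" for M i j
  proof -
    have "M $$ (j, i) = transpose_mat M $$ (i, j)" using that(2-4) by simp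
    then show ?thesis by (simp only: that(1))
  qed
  have "edge_term e $$ (j, i) = edge_term e $$ (i, j)" if "e \<in> follower_edges" "i < n" "j < n" for e i j
    using that by (intro entry sym edge_term_carrier weight_spd incidence_carrier) auto
  moreover have "source_term s $$ (j, i) = source_term s $$ (i, j)" if "s \<in> sources G" "i < n" "j < n" for s i j
    using that by (intro entry sym source_term_carrier weight_spd block_unit_carrier leader_of(2)) auto
  ultimately show ?thesis
    by (intro eq_matI) (auto simp: dirichlet_laplacian_def intro!: arg_cong2[where f = "(+)"] sum.cong)
qed

text \<open>This is the Dirichlet energy of the potentials \<open>z\<close> with the leaders
  grounded: each factor U of a summand U W U^T moves to the other side of the scalar
  product.\<close>

lemma laplacian_quadratic_form:
  assumes x: "x \<in> carrier_vec n"
  defines "z \<equiv> block k G x"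
  shows "x \<bullet> (A *\<^sub>v x) =
    (\<Sum>e\<in>follower_edges. (z (Min e) - z (Max e)) \<bullet> (weight G e *\<^sub>v (z (Min e) - z (Max e)))) +
    (\<Sum>i\<in>sources G. z i \<bullet> (weight G {leader_of G i, i} *\<^sub>v z i))"
proof -
  have z [simp]: "z u \<in> carrier_vec k" for u by (simp add: z_def)
  have W: "weight G e \<in> carrier_mat k k" if "e \<in> edges G" for e using spd_carrier[OF weight_spd[OF that]] .
  have move: "x \<bullet> (U *\<^sub>v y) = (transpose_mat U *\<^sub>v x) \<bullet> y" if "U \<in> carrier_mat n k" "y \<in> carrier_vec k" for U y
    using transpose_vec_mult_scalar[OF that x] by simp
  have "x \<bullet> (A *\<^sub>v x) = (\<Sum>r<n. x $ r * (A *\<^sub>v x) $ r)"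
    by (rule scalar_prod_eq_sum[OF mult_mat_vec_carrier[OF laplacian_carrier x]])
  also have "\<dots> = (\<Sum>r<n. x $ r * ((\<Sum>e\<in>follower_edges. (edge_term e *\<^sub>v x) $ r) + (\<Sum>i\<in>sources G. (source_term i *\<^sub>v x) $ r)))"
    by (intro sum.cong refl) (simp only: laplacian_mult[OF x] lessThan_iff)
  also have "\<dots> = (\<Sum>e\<in>follower_edges. \<Sum>r<n. x $ r * (edge_term e *\<^sub>v x) $ r) +
      (\<Sum>i\<in>sources G. \<Sum>r<n. x $ r * (source_term i *\<^sub>v x) $ r)"
    by (simp add: distrib_left sum.distrib sum_distrib_left sum.swap[of _ "{..<n}"])
  also have "(\<Sum>e\<in>follower_edges. \<Sum>r<n. x $ r * (edge_term e *\<^sub>v x) $ r) =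
      (\<Sum>e\<in>follower_edges. (z (Min e) - z (Max e)) \<bullet> (weight G e *\<^sub>v (z (Min e) - z (Max e))))"
  proof (rule sum.cong)
    fix e assume e: "e \<in> follower_edges"
    have "(\<Sum>r<n. x $ r * (edge_term e *\<^sub>v x) $ r) = x \<bullet> (edge_term e *\<^sub>v x)"
      using e by (intro scalar_prod_eq_sum[symmetric] mult_mat_vec_carrier[OF edge_term_carrier x]) simp
    also have "\<dots> = (transpose_mat (incidence e) *\<^sub>v x) \<bullet> (weight G e *\<^sub>v (z (Min e) - z (Max e)))"
      using W[of e] e unfolding edge_term_mult[OF e x] z_def[symmetric] by (intro move) auto
    finally show "(\<Sum>r<n. x $ r * (edge_term e *\<^sub>v x) $ r) =
        (z (Min e) - z (Max e)) \<bullet> (weight G e *\<^sub>v (z (Min e) - z (Max e)))"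
      by (simp only: transpose_incidence_mult[OF e x] z_def)
  qed simp
  also have "(\<Sum>i\<in>sources G. \<Sum>r<n. x $ r * (source_term i *\<^sub>v x) $ r) =
      (\<Sum>i\<in>sources G. z i \<bullet> (weight G {leader_of G i, i} *\<^sub>v z i))"
  proof (rule sum.cong)
    fix i assume i: "i \<in> sources G"
    have "(\<Sum>r<n. x $ r * (source_term i *\<^sub>v x) $ r) = x \<bullet> (source_term i *\<^sub>v x)"
      by (intro scalar_prod_eq_sum[symmetric] mult_mat_vec_carrier[OF source_term_carrier[OF i] x])
    also have "\<dots> = (transpose_mat (block_unit k G i) *\<^sub>v x) \<bullet> (weight G {leader_of G i, i} *\<^sub>v z i)"
      using W[OF leader_of(2)[OF i]] unfolding source_term_mult[OF i x] z_def[symmetric] by (intro move) auto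
    finally show "(\<Sum>r<n. x $ r * (source_term i *\<^sub>v x) $ r) = z i \<bullet> (weight G {leader_of G i, i} *\<^sub>v z i)"
      using i sources_followers x by (auto simp: transpose_block_unit_mult z_def)
  qed simp
  finally show ?thesis .
qed

text \<open>If the energy is not positive, every term of it vanishes. Potentials then agree across
  each follower edge and are zero at the sources, and connectivity with some leader forces them to
  be zero everywhere.\<close>

lemma laplacian_spd: "A \<in> spd n"
proof -
  have "0 < x \<bullet> (A *\<^sub>v x)" if x: "x \<in> carrier_vec n" "x \<noteq> 0\<^sub>v n" for x
  proof (rule ccontr)
    define z where "z = block k G x"
    have z [simp]: "z u \<in> carrier_vec k" for u by (simp add: z_def)
    let ?q = "\<lambda>e. (z (Min e) - z (Max e)) \<bullet> (weight G e *\<^sub>v (z (Min e) - z (Max e)))"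
    let ?q' = "\<lambda>i. z i \<bullet> (weight G {leader_of G i, i} *\<^sub>v z i)"
    have psd: "0 \<le> y \<bullet> (weight G e *\<^sub>v y)" "y \<bullet> (weight G e *\<^sub>v y) = 0 \<Longrightarrow> y = 0\<^sub>v k"
      if "e \<in> edges G" "y \<in> carrier_vec k" for e y
      using spd_pos[OF weight_spd[OF that(1)] that(2)] spd_carrier[OF weight_spd[OF that(1)]] that(2)
      by (cases "y = 0\<^sub>v k"; force)+
    have q: "0 \<le> ?q e" if "e \<in> follower_edges" for e using that by (intro psd) auto
    have q': "0 \<le> ?q' i" if "i \<in> sources G" for i using leader_of(2)[OF that] by (intro psd) auto
    assume "\<not> 0 < x \<bullet> (A *\<^sub>v x)"
    then have le: "sum ?q follower_edges + sum ?q' (sources G) \<le> 0"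
      using laplacian_quadratic_form[OF x(1)] by (simp add: z_def)
    have "0 \<le> sum ?q follower_edges" "0 \<le> sum ?q' (sources G)"
      using q q' by (auto intro!: sum_nonneg)
    with le have zero: "sum ?q follower_edges = 0" "sum ?q' (sources G) = 0" by linarith+
    have "finite follower_edges" using finite_edges by simp
    then have q0: "?q e = 0" if "e \<in> follower_edges" for e
      using sum_nonneg_eq_0_iff[of follower_edges ?q] q zero(1) that by blast
    have q'0: "?q' i = 0" if "i \<in> sources G" for i
      using sum_nonneg_eq_0_iff[of "sources G" ?q'] q' zero(2) that finite_sources by blast
    \<comment> \<open>Extends the potentials by zero to the leaders, so that they are constant along
      every edge of the graph and a single induction along a path to a leader suffices.\<close>
    define zz where "zz v = (if v \<in> leaders G then 0\<^sub>v k else z v)" for v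
    have zS: "zz v = 0\<^sub>v k" if v: "v \<in> sources G" for v
      using psd(2)[OF leader_of(2)[OF v] _ q'0[OF v]] v by (auto simp: zz_def)
    have step: "zz a = zz b" if ab: "{a, b} \<in> edges G" for a b
    proof -
      consider "a \<in> leaders G" | "b \<in> leaders G" | "a \<notin> leaders G" "b \<notin> leaders G" by blast
      then show ?thesis
      proof cases
        case 1 then show ?thesis using zS[OF leader_neighbour[OF 1 ab]] by (simp add: zz_def)
      next
        case 2
        have "{b, a} \<in> edges G" using ab by (simp add: insert_commute)
        with 2 show ?thesis using zS[OF leader_neighbour[OF 2]] by (simp add: zz_def)
      next
        case 3
        then have e: "{a, b} \<in> follower_edges" using edge_nodes[OF ab] ab by (auto simp: followers_def doubleton_eq_iff)
        have *: "z (Min {a, b}) - z (Max {a, b}) = 0\<^sub>v k" using psd(2)[OF ab _ q0[OF e]] by simp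
        have "z (Min {a, b}) = z (Max {a, b})"
        proof (rule eq_vecI)
          fix p assume "p < dim_vec (z (Max {a, b}))"
          then have "p < k" using z by (metis carrier_vecD)
          with arg_cong[OF *, of "\<lambda>y. y $ p"] show "z (Min {a, b}) $ p = z (Max {a, b}) $ p"
            using carrier_vecD[OF z] by simp
        qed (simp add: carrier_vecD[OF z])
        then have "z a = z b" by (cases "a \<le> b") (auto simp: min_def max_def)
        with 3 show ?thesis by (simp add: zz_def)
      qed
    qed
    obtain r where r: "r \<in> leaders G" using leaders_nonempty by blast
    have "z v = 0\<^sub>v k" if v: "v \<in> followers G" for v
    proof -
      have "(v, r) \<in> {(a, b). {a, b} \<in> edges G}\<^sup>*"
        using v r leaders_nodes by (intro connected) (auto simp: followers_def)
      then have "zz v = zz r" by (induction rule: rtrancl_induct) (simp_all add: step)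
      with v r show ?thesis by (auto simp: zz_def followers_def)
    qed
    moreover have "block k G (0\<^sub>v n) v = 0\<^sub>v k" if "v \<in> followers G" for v
      using row_index_less[OF that] by (intro eq_vecI) (auto simp: block_def)
    ultimately have "block k G x v = block k G (0\<^sub>v n) v" if "v \<in> followers G" for v
      using that by (simp add: z_def)
    then have "x = 0\<^sub>v n" by (rule vec_eq_blockI[OF x(1) zero_carrier_vec])
    with x(2) show False by simp
  qed
  with laplacian_symmetric show ?thesis by (simp add: spd_def)
qed

end

section \<open>Effective resistance of series-parallel graphs\<close>

text \<open>Currents depend only on potential differences along edges. Raising all potentials of one
  part by a constant is therefore harmless, which the series join exploits.\<close>

lemma outflow_cong:
  assumes "\<And>u. {u, v} \<in> E \<Longrightarrow> X v - X u = Y v - Y u"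
  shows "outflow w E X v p = outflow w E Y v p"
  unfolding outflow_def using assms by (intro sum.cong) auto

lemma outflow_outside: "(\<And>u. {u, v} \<notin> E) \<Longrightarrow> outflow w E X v p = 0"
  by (simp add: outflow_def)

lemma outflow_Un:
  assumes "finite {u. {u, v} \<in> E1}" "finite {u. {u, v} \<in> E2}" "E1 \<inter> E2 = {}"
  shows "outflow w (E1 \<union> E2) X v p = outflow w E1 X v p + outflow w E2 X v p"
proof -
  have "{u. {u, v} \<in> E1 \<union> E2} = {u. {u, v} \<in> E1} \<union> {u. {u, v} \<in> E2}" by auto
  moreover have "{u. {u, v} \<in> E1} \<inter> {u. {u, v} \<in> E2} = {}" using assms(3) by auto
  ultimately show ?thesis using assms by (simp add: outflow_def sum.union_disjoint)
qed

lemma simple_graph_edge: "simple_graph V E \<Longrightarrow> {u, v} \<in> E \<Longrightarrow> u \<in> V \<and> v \<in> V \<and> u \<noteq> v"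
  by (auto simp: simple_graph_def subset_eq doubleton_eq_iff dest!: bspec)

lemma simple_graph_finite_neighbours: "simple_graph V E \<Longrightarrow> finite {u. {u, v} \<in> E}"
  by (rule finite_subset[of _ V]) (auto simp: simple_graph_edge simple_graph_def[of V E, THEN iffD1])

lemma simple_graph_Un: "simple_graph V1 E1 \<Longrightarrow> simple_graph V2 E2 \<Longrightarrow> simple_graph (V1 \<union> V2) (E1 \<union> E2)"
  unfolding simple_graph_def by (intro conjI Un_least) blast+

lemma decomposition_tree_graph:
  "decomposition_tree T V E s t \<Longrightarrow> simple_graph V E \<and> s \<in> V \<and> t \<in> V \<and> s \<noteq> t"
proof (induction rule: decomposition_tree.induct)
  case (leaf s t)
  then show ?case by (auto simp: simple_graph_def)
next
  case (parallel T1 V1 E1 s t T2 V2 E2)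
  then show ?case using simple_graph_Un by blast
next
  case (series T1 V1 E1 s c T2 V2 E2 t)
  then show ?case using simple_graph_Un by blast
qed

text \<open>A common edge would put two distinct endpoints into the single common vertex.\<close>

lemma series_edges_disjoint:
  assumes "simple_graph V1 E1" "simple_graph V2 E2" "V1 \<inter> V2 = {c}"
  shows "E1 \<inter> E2 = {}"
proof (rule ccontr)
  assume "E1 \<inter> E2 \<noteq> {}"
  then obtain e where e: "e \<in> E1" "e \<in> E2" by blast
  then obtain u v where uv: "e = {u, v}" using assms(1) unfolding simple_graph_def by blast
  have "u \<in> V1 \<inter> V2" "v \<in> V1 \<inter> V2" "u \<noteq> v"
    using simple_graph_edge[OF assms(1)] simple_graph_edge[OF assms(2)] e uv by blast+
  then show False unfolding assms(3) by blast
qed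

text \<open>Edge weights are conductances, hence the inversion at a leaf. The factor 1/2 in
  \<open>finish\<close> is what remains of pi / d after division by 2 pi in the norm.\<close>

definition resistance_algorithm :: tree_algorithm where
  "resistance_algorithm =
    \<lparr>at_leaf = MInv (MVar 0),
     at_series = MAdd (MVar 0) (MVar 1),
     at_parallel = MInv (MAdd (MInv (MVar 0)) (MInv (MVar 1))),
     accumulate = SAdd SAcc (STrace (MVar 0)),
     finish = SSqrt (SMul (SConst (1 / 2)) SAcc)\<rparr>"

text \<open>Potentials \<open>X\<close>, grounded at \<open>t\<close>, that drive the current \<open>i\<close> from \<open>s\<close> to \<open>t\<close>.\<close>

definition electrical_flow ::
    "nat \<Rightarrow> ('v set \<Rightarrow> real mat) \<Rightarrow> 'v set \<Rightarrow> 'v set set \<Rightarrow> 'v \<Rightarrow> 'v \<Rightarrow> real vec \<Rightarrow> ('v \<Rightarrow> real vec) \<Rightarrow> bool"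
  where "electrical_flow k w V E s t i X \<longleftrightarrow>
    (\<forall>v. X v \<in> carrier_vec k) \<and> X t = 0\<^sub>v k \<and>
    (\<forall>v\<in>V. \<forall>p<k. outflow w E X v p = (if v = s then i $ p else if v = t then - (i $ p) else 0))"

lemma electrical_flow_leaf:
  assumes st: "s \<noteq> t" and W: "w {s, t} \<in> carrier_mat k k" and U: "U \<in> carrier_mat k k"
    and WU: "w {s, t} * U = 1\<^sub>m k" and i: "i \<in> carrier_vec k"
  shows "electrical_flow k w {s, t} {{s, t}} s t i (\<lambda>v. if v = s then U *\<^sub>v i else 0\<^sub>v k)"
proof -
  let ?X = "\<lambda>v. if v = s then U *\<^sub>v i else 0\<^sub>v k"
  have Ui: "U *\<^sub>v i \<in> carrier_vec k" by (rule mult_mat_vec_carrier[OF U i])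
  have WUi: "w {s, t} *\<^sub>v (U *\<^sub>v i) = i" 
    using assoc_mult_mat_vec[OF W U i] WU i by simp
  have W0: "w {s, t} *\<^sub>v 0\<^sub>v k = 0\<^sub>v k" using W by (intro eq_vecI) auto
  have "{u. {u, s} \<in> {{s, t}}} = {t}" "{u. {u, t} \<in> {{s, t}}} = {s}"
    using st by (auto simp: doubleton_eq_iff)
  then have "outflow w {{s, t}} ?X s p = (w {s, t} *\<^sub>v (U *\<^sub>v i - 0\<^sub>v k)) $ p"
    "outflow w {{s, t}} ?X t p = (w {s, t} *\<^sub>v (0\<^sub>v k - U *\<^sub>v i)) $ p" for p
    using st by (simp_all add: outflow_def insert_commute)
  then have "outflow w {{s, t}} ?X s p = i $ p" "outflow w {{s, t}} ?X t p = - (i $ p)" if "p < k" for p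
    using that mult_minus_distrib_mat_vec[OF W Ui zero_carrier_vec]
      mult_minus_distrib_mat_vec[OF W zero_carrier_vec Ui] i W
    by (simp_all add: WUi W0)
  then show ?thesis using st Ui by (auto simp: electrical_flow_def)
qed

text \<open>The same current passes through both parts. The first part is grounded at
  \<open>c\<close>, so its potentials are raised by \<open>X2 c\<close> to match the second part
  there; the current arriving at \<open>c\<close> and the current leaving it cancel.\<close>

lemma electrical_flow_series:
  assumes g1: "simple_graph V1 E1" "s \<in> V1" "c \<in> V1" "s \<noteq> c"
    and g2: "simple_graph V2 E2" "c \<in> V2" "t \<in> V2" "c \<noteq> t" and c: "V1 \<inter> V2 = {c}"
    and X1: "electrical_flow k w V1 E1 s c i X1" and X2: "electrical_flow k w V2 E2 c t i X2"
  shows "electrical_flow k w (V1 \<union> V2) (E1 \<union> E2) s t i (\<lambda>v. if v \<in> V1 then X1 v + X2 c else X2 v)"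
proof -
  let ?X = "\<lambda>v. if v \<in> V1 then X1 v + X2 c else X2 v"
  have carrier: "X1 v \<in> carrier_vec k" "X2 v \<in> carrier_vec k" for v
    using X1 X2 by (auto simp: electrical_flow_def)
  have mem: "s \<notin> V2" "t \<notin> V1"
    using g1(2,4) g2(3,4) c by (metis IntI singletonD)+
  have eq2: "?X v = X2 v" if "v \<in> V2" for v
  proof (cases "v \<in> V1")
    case True
    then have "v = c" using c that by (metis IntI singletonD)
    then show ?thesis using X1 carrier by (simp add: electrical_flow_def)
  qed simp
  have o1: "outflow w E1 ?X v p = (if v \<in> V1 then if v = s then i $ p else if v = c then - (i $ p) else 0 else 0)"
    if p: "p < k" for v p
  proof (cases "v \<in> V1")
    case True
    have "?X v - ?X u = X1 v - X1 u" if "{u, v} \<in> E1" for u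
      using simple_graph_edge[OF g1(1) that] carrier_vecD[OF carrier(1)] carrier_vecD[OF carrier(2)]
      by (intro eq_vecI) auto
    then have "outflow w E1 ?X v p = outflow w E1 X1 v p" by (rule outflow_cong)
    with True X1 p show ?thesis by (auto simp: electrical_flow_def)
  next
    case False
    then show ?thesis using outflow_outside[of v E1] simple_graph_edge[OF g1(1)] by (metis (no_types, lifting))
  qed
  have o2: "outflow w E2 ?X v p = (if v \<in> V2 then if v = c then i $ p else if v = t then - (i $ p) else 0 else 0)"
    if p: "p < k" for v p
  proof (cases "v \<in> V2")
    case True
    have "?X v - ?X u = X2 v - X2 u" if "{u, v} \<in> E2" for u
      using simple_graph_edge[OF g2(1) that] eq2 by metis
    then have "outflow w E2 ?X v p = outflow w E2 X2 v p" by (rule outflow_cong)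
    with True X2 p show ?thesis by (auto simp: electrical_flow_def)
  next
    case False
    then show ?thesis using outflow_outside[of v E2] simple_graph_edge[OF g2(1)] by (metis (no_types, lifting))
  qed
  have "outflow w (E1 \<union> E2) ?X v p = outflow w E1 ?X v p + outflow w E2 ?X v p" for v p
    by (intro outflow_Un simple_graph_finite_neighbours[OF g1(1)] simple_graph_finite_neighbours[OF g2(1)]
        series_edges_disjoint[OF g1(1) g2(1) c])
  then have "outflow w (E1 \<union> E2) ?X v p = (if v = s then i $ p else if v = t then - (i $ p) else 0)"
    if "p < k" "v \<in> V1 \<union> V2" for v p
    using that g1(2-) g2(2-) mem c o1[OF that(1), of v] o2[OF that(1), of v] by auto
  moreover have "?X t = 0\<^sub>v k" using mem X2 by (simp add: electrical_flow_def)
  ultimately show ?thesis using carrier by (simp add: electrical_flow_def)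
qed

text \<open>Both parts are grounded at \<open>t\<close> and agree at \<open>s\<close> by
  \<open>eq\<close>, so their potentials can be glued unchanged, and the currents add at the
  terminals.\<close>

lemma electrical_flow_parallel:
  assumes g1: "simple_graph V1 E1" and g2: "simple_graph V2 E2" and st: "s \<noteq> t"
    and V: "V1 \<inter> V2 = {s, t}" and E: "E1 \<inter> E2 = {}"
    and X1: "electrical_flow k w V1 E1 s t i1 X1" and X2: "electrical_flow k w V2 E2 s t i2 X2"
    and i: "i1 \<in> carrier_vec k" "i2 \<in> carrier_vec k" and eq: "X1 s = X2 s"
  shows "electrical_flow k w (V1 \<union> V2) (E1 \<union> E2) s t (i1 + i2) (\<lambda>v. if v \<in> V1 then X1 v else X2 v)"
proof -
  let ?X = "\<lambda>v. if v \<in> V1 then X1 v else X2 v"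
  have eq2: "?X v = X2 v" if "v \<in> V2" for v
  proof (cases "v \<in> V1")
    case True
    then have "v \<in> V1 \<inter> V2" using that by simp
    then have "v = s \<or> v = t" unfolding V by simp
    then show ?thesis using X1 X2 eq by (auto simp: electrical_flow_def)
  qed simp
  have "s \<in> V1 \<inter> V2" "t \<in> V1 \<inter> V2" unfolding V by simp_all
  then have mem: "s \<in> V1" "t \<in> V1" "s \<in> V2" "t \<in> V2" by simp_all
  have o1: "outflow w E1 ?X v p = (if v \<in> V1 then if v = s then i1 $ p else if v = t then - (i1 $ p) else 0 else 0)"
    if p: "p < k" for v p
  proof (cases "v \<in> V1")
    case True
    have "?X v - ?X u = X1 v - X1 u" if "{u, v} \<in> E1" for u
      using simple_graph_edge[OF g1 that] by simp
    then have "outflow w E1 ?X v p = outflow w E1 X1 v p" by (rule outflow_cong)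
    with True X1 p show ?thesis by (auto simp: electrical_flow_def)
  next
    case False
    then show ?thesis using outflow_outside[of v E1] simple_graph_edge[OF g1] by (metis (no_types, lifting))
  qed
  have o2: "outflow w E2 ?X v p = (if v \<in> V2 then if v = s then i2 $ p else if v = t then - (i2 $ p) else 0 else 0)"
    if p: "p < k" for v p
  proof (cases "v \<in> V2")
    case True
    have "?X v - ?X u = X2 v - X2 u" if "{u, v} \<in> E2" for u
      using simple_graph_edge[OF g2 that] eq2 by metis
    then have "outflow w E2 ?X v p = outflow w E2 X2 v p" by (rule outflow_cong)
    with True X2 p show ?thesis by (auto simp: electrical_flow_def)
  next
    case False
    then show ?thesis using outflow_outside[of v E2] simple_graph_edge[OF g2] by (metis (no_types, lifting))
  qed
  have "outflow w (E1 \<union> E2) ?X v p = outflow w E1 ?X v p + outflow w E2 ?X v p" for v p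
    by (intro outflow_Un simple_graph_finite_neighbours[OF g1] simple_graph_finite_neighbours[OF g2] E)
  then have "outflow w (E1 \<union> E2) ?X v p = (if v = s then (i1 + i2) $ p else if v = t then - ((i1 + i2) $ p) else 0)"
    if "p < k" "v \<in> V1 \<union> V2" for v p
    using that mem st i o1[OF that(1), of v] o2[OF that(1), of v] by auto
  moreover have "?X t = 0\<^sub>v k" using mem X1 by (simp add: electrical_flow_def)
  ultimately show ?thesis using X1 X2 by (simp add: electrical_flow_def)
qed

text \<open>Quantifying over all currents \<open>i\<close> is what the induction needs: a series
  join passes the same \<open>i\<close> to both parts, while a parallel join passes different
  currents to its branches. Positive definiteness of \<open>R\<close> makes the inversions at
  parallel joins succeed.\<close>

lemma tree_value_resistance:
  assumes "decomposition_tree T V E s t" "\<And>e. e \<in> E \<Longrightarrow> w e \<in> spd k"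
  shows "\<exists>R\<in>spd k. tree_value resistance_algorithm k w T = Some R \<and>
    (\<forall>i\<in>carrier_vec k. \<exists>X. electrical_flow k w V E s t i X \<and> X s = R *\<^sub>v i)"
  using assms
proof (induction rule: decomposition_tree.induct)
  case (leaf s t)
  have W: "w {s, t} \<in> spd k" using leaf by simp
  obtain U where U: "mat_inverse (w {s, t}) = Some U" "U \<in> spd k" "w {s, t} * U = 1\<^sub>m k"
    using spd_inverse[OF W] by metis
  have "\<exists>X. electrical_flow k w {s, t} {{s, t}} s t i X \<and> X s = U *\<^sub>v i" if "i \<in> carrier_vec k" for i
    by (rule exI, rule conjI, rule electrical_flow_leaf[where w = w, OF leaf(1) spd_carrier[OF W] spd_carrier[OF U(2)] U(3) that]) simp
  then show ?case using U by (intro bexI[of _ U]) (auto simp: resistance_algorithm_def)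
next
  case (parallel T1 V1 E1 s t T2 V2 E2)
  obtain R1 where R1: "R1 \<in> spd k" "tree_value resistance_algorithm k w T1 = Some R1"
    "\<And>i. i \<in> carrier_vec k \<Longrightarrow> \<exists>X. electrical_flow k w V1 E1 s t i X \<and> X s = R1 *\<^sub>v i"
    using parallel by (metis UnCI)
  obtain R2 where R2: "R2 \<in> spd k" "tree_value resistance_algorithm k w T2 = Some R2"
    "\<And>i. i \<in> carrier_vec k \<Longrightarrow> \<exists>X. electrical_flow k w V2 E2 s t i X \<and> X s = R2 *\<^sub>v i"
    using parallel by (metis UnCI)
  obtain U1 where U1: "mat_inverse R1 = Some U1" "U1 \<in> spd k" "R1 * U1 = 1\<^sub>m k"
    using spd_inverse[OF R1(1)] by metis
  obtain U2 where U2: "mat_inverse R2 = Some U2" "U2 \<in> spd k" "R2 * U2 = 1\<^sub>m k"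
    using spd_inverse[OF R2(1)] by metis
  obtain R where R: "mat_inverse (U1 + U2) = Some R" "R \<in> spd k" "(U1 + U2) * R = 1\<^sub>m k"
    using spd_inverse[OF spd_add[OF U1(2) U2(2)]] by metis
  note c1 = spd_carrier[OF R1(1)] spd_carrier[OF U1(2)] and c2 = spd_carrier[OF R2(1)] spd_carrier[OF U2(2)]
    and c = spd_carrier[OF R(2)]
  have "\<exists>X. electrical_flow k w (V1 \<union> V2) (E1 \<union> E2) s t i X \<and> X s = R *\<^sub>v i" if i: "i \<in> carrier_vec k" for i
  proof -
    \<comment> \<open>The common potential at \<open>s\<close>. The branches receive the currents
      \<open>U1 *\<^sub>v j\<close> and \<open>U2 *\<^sub>v j\<close> that this potential drives;
      their sum is \<open>(U1 + U2) * R\<close> applied to \<open>i\<close>, which is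
      \<open>i\<close>.\<close>
    define j where "j = R *\<^sub>v i"
    have j: "j \<in> carrier_vec k" unfolding j_def by (rule mult_mat_vec_carrier[OF c i])
    have j1: "U1 *\<^sub>v j \<in> carrier_vec k" and j2: "U2 *\<^sub>v j \<in> carrier_vec k"
      using c1 c2 j by (auto intro: mult_mat_vec_carrier)
    have "R1 *\<^sub>v (U1 *\<^sub>v j) = j" "R2 *\<^sub>v (U2 *\<^sub>v j) = j"
      using assoc_mult_mat_vec[OF c1 j] assoc_mult_mat_vec[OF c2 j] U1(3) U2(3) j by simp_all
    then obtain X1 X2 where X: "electrical_flow k w V1 E1 s t (U1 *\<^sub>v j) X1" "X1 s = j"
        "electrical_flow k w V2 E2 s t (U2 *\<^sub>v j) X2" "X2 s = j"
      using R1(3)[OF j1] R2(3)[OF j2] by metis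
    have "U1 *\<^sub>v j + U2 *\<^sub>v j = (U1 + U2) *\<^sub>v (R *\<^sub>v i)"
      unfolding j_def[symmetric] by (rule add_mult_distrib_mat_vec[OF c1(2) c2(2) j, symmetric])
    also have "\<dots> = i"
      using assoc_mult_mat_vec[OF add_carrier_mat[OF c2(2), of U1] c i] R(3) i by simp
    finally have sum: "U1 *\<^sub>v j + U2 *\<^sub>v j = i" .
    note g1 = decomposition_tree_graph[OF parallel(1)] and g2 = decomposition_tree_graph[OF parallel(2)]
    have "electrical_flow k w (V1 \<union> V2) (E1 \<union> E2) s t i (\<lambda>v. if v \<in> V1 then X1 v else X2 v)"
      using electrical_flow_parallel[OF _ _ _ parallel(3,4) X(1,3) j1 j2] g1 g2 X(2,4) sum by metis
    then show ?thesis using g1 X(2)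
      by (intro exI[of _ "\<lambda>v. if v \<in> V1 then X1 v else X2 v"] conjI) (auto simp: j_def)
  qed
  then show ?case using R R1(2) R2(2) U1(1) U2(1)
    by (intro bexI[of _ R]) (simp_all add: resistance_algorithm_def)
next
  case (series T1 V1 E1 s c T2 V2 E2 t)
  obtain R1 where R1: "R1 \<in> spd k" "tree_value resistance_algorithm k w T1 = Some R1"
    "\<And>i. i \<in> carrier_vec k \<Longrightarrow> \<exists>X. electrical_flow k w V1 E1 s c i X \<and> X s = R1 *\<^sub>v i"
    using series by (metis UnCI)
  obtain R2 where R2: "R2 \<in> spd k" "tree_value resistance_algorithm k w T2 = Some R2"
    "\<And>i. i \<in> carrier_vec k \<Longrightarrow> \<exists>X. electrical_flow k w V2 E2 c t i X \<and> X c = R2 *\<^sub>v i"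
    using series by (metis UnCI)
  note g1 = decomposition_tree_graph[OF series(1)] and g2 = decomposition_tree_graph[OF series(2)]
  have "\<exists>X. electrical_flow k w (V1 \<union> V2) (E1 \<union> E2) s t i X \<and> X s = (R1 + R2) *\<^sub>v i" if i: "i \<in> carrier_vec k" for i
  proof -
    obtain X1 X2 where X: "electrical_flow k w V1 E1 s c i X1" "X1 s = R1 *\<^sub>v i"
        "electrical_flow k w V2 E2 c t i X2" "X2 c = R2 *\<^sub>v i"
      using R1(3)[OF i] R2(3)[OF i] by metis
    have "electrical_flow k w (V1 \<union> V2) (E1 \<union> E2) s t i (\<lambda>v. if v \<in> V1 then X1 v + X2 c else X2 v)"
      using g1 g2 by (intro electrical_flow_series[OF _ _ _ _ _ _ _ _ series(3) X(1,3)]) auto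
    then show ?thesis
      using g1 X(2,4) add_mult_distrib_mat_vec[OF spd_carrier[OF R1(1)] spd_carrier[OF R2(1)] i]
      by (intro exI[of _ "\<lambda>v. if v \<in> V1 then X1 v + X2 c else X2 v"] conjI) auto
  qed
  then show ?case using R1 R2 spd_add[OF R1(1) R2(1)]
    by (intro bexI[of _ "R1 + R2"]) (simp_all add: resistance_algorithm_def)
qed

lemma accumulate_trees_resistance:
  assumes "\<And>T. T \<in> set Ts \<Longrightarrow> tree_value resistance_algorithm k w T \<noteq> None"
  shows "accumulate_trees resistance_algorithm k w Ts a =
    Some (a + (\<Sum>T\<leftarrow>Ts. mat_trace (the (tree_value resistance_algorithm k w T))))"
  using assms
proof (induction Ts arbitrary: a)
  case (Cons T Ts)
  obtain R where R: "tree_value resistance_algorithm k w T = Some R" using Cons.prems[of T] by auto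
  have "accumulate_trees resistance_algorithm k w (T # Ts) a =
      accumulate_trees resistance_algorithm k w Ts (a + mat_trace R)"
    by (simp add: R) (simp add: resistance_algorithm_def)
  also have "\<dots> = Some (a + mat_trace R + (\<Sum>T\<leftarrow>Ts. mat_trace (the (tree_value resistance_algorithm k w T))))"
    using Cons.prems by (intro Cons.IH) simp
  finally show ?case by (simp add: R add.assoc)
qed simp

text \<open>
  A parallel join with the single edge \<open>{s, t}\<close> adds no node, hence the case distinction: in a
  simple graph such a join happens at most once for the same terminals.
\<close>

lemma tree_height_le:
  "decomposition_tree T V E s t \<Longrightarrow>
    tree_height T + 4 \<le> 2 * card V \<and> ({s, t} \<notin> E \<longrightarrow> tree_height T + 5 \<le> 2 * card V)"
proof (induction rule: decomposition_tree.induct)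
  case (leaf s t)
  then show ?case by simp
next
  case (parallel T1 V1 E1 s t T2 V2 E2)
  note g1 = decomposition_tree_graph[OF parallel(1)] and g2 = decomposition_tree_graph[OF parallel(2)]
  have "finite V1" "finite V2" using g1 g2 by (auto simp: simple_graph_def)
  then have "card V1 + card V2 = card (V1 \<union> V2) + 2"
    using card_Un_Int[of V1 V2] g1 parallel(3) by simp
  \<comment> \<open>Two vertices are shared, so the weaker bounds of both operands leave no room for
    the additional level. One operand lacks the edge between the terminals, and its sharper bound
    provides the missing unit.\<close>
  moreover have "{s, t} \<notin> E1 \<or> {s, t} \<notin> E2" using parallel(4) by blast
  moreover have "{s, t} \<notin> E1 \<union> E2 \<longrightarrow> {s, t} \<notin> E1 \<and> {s, t} \<notin> E2" by blast
  ultimately show ?case using parallel.IH unfolding tree_height.simps by linarith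
next
  case (series T1 V1 E1 s c T2 V2 E2 t)
  note g1 = decomposition_tree_graph[OF series(1)] and g2 = decomposition_tree_graph[OF series(2)]
  have "finite V1" "finite V2" using g1 g2 by (auto simp: simple_graph_def)
  \<comment> \<open>Only one vertex is shared here, so the weaker bounds of the operands already
    give the sharper bound for the join.\<close>
  then have "card V1 + card V2 = card (V1 \<union> V2) + 1"
    using card_Un_Int[of V1 V2] series(3) by simp
  then show ?case using series.IH unfolding tree_height.simps by linarith
qed

section \<open>Cost of evaluating one tree\<close>

lemma layer_node_costs_cases:
  "layer_node_costs alg mc k T d \<subseteq>
    {mcost mc k (at_leaf alg), mcost mc k (at_series alg), mcost mc k (at_parallel alg)}"
  by (induction alg mc k T d rule: layer_node_costs.induct) auto

text \<open>\<open>Max\<close> of an empty set carries no information, so every layer counted by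
  \<open>tree_cost\<close> must contain a node.\<close>

lemma layer_node_costs_nonempty: "d \<le> tree_height T \<Longrightarrow> layer_node_costs alg mc k T d \<noteq> {}"
  by (induction alg mc k T d rule: layer_node_costs.induct) (auto simp: max_def split: if_splits)

lemma tree_cost_le:
  assumes "mcost mc k (at_leaf alg) \<le> M" "mcost mc k (at_series alg) \<le> M" "mcost mc k (at_parallel alg) \<le> M"
  shows "tree_cost alg mc k T \<le> (tree_height T + 1) * M"
proof -
  have "Max (layer_node_costs alg mc k T d) \<le> M" if "d \<le> tree_height T" for d
    using layer_node_costs_cases[of alg mc k T d] layer_node_costs_nonempty[OF that] assms
    by (subst Max_le_iff) (auto intro: finite_subset)
  then have "tree_cost alg mc k T \<le> (\<Sum>d\<le>tree_height T. M)"
    unfolding tree_cost_def by (intro sum_mono) simp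
  then show ?thesis by simp
qed

section \<open>Diagonal blocks of the inverse Laplacian\<close>

context leader_follower_graph
begin

section \<open>The graph with merged leaders\<close>

lemma merge_simps: "r \<in> leaders G \<Longrightarrow> merge G r = None" "v \<in> followers G \<Longrightarrow> merge G v = Some v"
  by (auto simp: merge_def followers_def)

lemma edge_cases:
  assumes "e \<in> edges G"
  obtains (follower) u v where "e = {u, v}" "u \<in> followers G" "v \<in> followers G" "merge G ` e = {Some u, Some v}"
  | (source) i where "i \<in> sources G" "e = {leader_of G i, i}" "merge G ` e = {None, Some i}"
proof -
  obtain u v where e: "e = {u, v}" and uv: "u \<in> nodes G" "v \<in> nodes G" using edge_nodes[OF assms] by metis
  note follower = that(1) and source = that(2)
  have leader: thesis if "a \<in> leaders G" "e = {a, b}" for a b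
  proof (rule source)
    have ab: "{a, b} \<in> edges G" using assms that(2) by simp
    show b: "b \<in> sources G" by (rule leader_neighbour[OF that(1) ab])
    show "e = {leader_of G b, b}" using leader_of_eq[OF that(1) ab] that(2) by simp
    show "merge G ` e = {None, Some b}"
      using b that sources_followers merge_simps by (simp add: subset_iff)
  qed
  consider "u \<in> leaders G" | "v \<in> leaders G" | "u \<in> followers G" "v \<in> followers G"
    using uv by (auto simp: followers_def)
  then show thesis
  proof cases
    case 1 then show thesis by (rule leader[OF _ e])
  next
    case 2 then show thesis by (rule leader) (simp add: e insert_commute)
  next
    case 3 then show thesis by (intro follower[OF e]) (simp_all add: e merge_simps)
  qed
qed

text \<open>An edge to a leader is recovered from its follower endpoint through
  \<open>leader_of\<close>, and an edge between followers is only relabelled. The node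
  \<open>None\<close> tells the two kinds apart.\<close>

lemma inj_on_merge: "inj_on (\<lambda>e. merge G ` e) (edges G)"
proof (rule inj_onI)
  fix e e' assume e: "e \<in> edges G" and e': "e' \<in> edges G" and eq: "merge G ` e = merge G ` e'"
  from e show "e = e'"
  proof (cases rule: edge_cases)
    case u: (follower u v)
    from e' show ?thesis
    proof (cases rule: edge_cases)
      case v: (follower u' v')
      from eq[unfolded u(4) v(4)] show ?thesis unfolding u(1) v(1) by (simp add: doubleton_eq_iff)
    next
      case v: (source i)
      from eq[unfolded u(4) v(3)] show ?thesis by (simp add: doubleton_eq_iff)
    qed
  next
    case u: (source i)
    from e' show ?thesis
    proof (cases rule: edge_cases)
      case v: (follower u' v')
      from eq[unfolded u(3) v(4)] show ?thesis by (simp add: doubleton_eq_iff)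
    next
      case v: (source i')
      from eq[unfolded u(3) v(3)] show ?thesis unfolding u(2) v(2) by (simp add: doubleton_eq_iff)
    qed
  qed
qed

lemma merged_weight_merge: "e \<in> edges G \<Longrightarrow> merged_weight G (merge G ` e) = weight G e"
  unfolding merged_weight_def using inv_into_f_f[OF inj_on_merge] by simp

lemma merged_weight_spd: "e \<in> merged_edges G \<Longrightarrow> merged_weight G e \<in> spd k"
  unfolding merged_edges_def using merged_weight_merge weight_spd by fastforce

lemma merged_follower_edge:
  assumes "v \<in> followers G"
  shows "{Some u, Some v} \<in> merged_edges G \<longleftrightarrow> u \<in> followers G \<and> {u, v} \<in> edges G"
proof
  assume "{Some u, Some v} \<in> merged_edges G"
  then obtain e where e: "e \<in> edges G" "merge G ` e = {Some u, Some v}" by (auto simp: merged_edges_def)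
  from e(1) show "u \<in> followers G \<and> {u, v} \<in> edges G"
  proof (cases rule: edge_cases)
    case ab: (follower a b)
    have "u = a \<and> v = b \<or> u = b \<and> v = a" using e(2)[unfolded ab(4)] by (auto simp: doubleton_eq_iff)
    then show ?thesis using ab(1-3) e(1) by (auto simp: insert_commute)
  next
    case (source i)
    from e(2)[unfolded source(3)] show ?thesis by (simp add: doubleton_eq_iff)
  qed
next
  assume "u \<in> followers G \<and> {u, v} \<in> edges G"
  moreover from this assms have "merge G ` {u, v} = {Some u, Some v}" by (simp add: merge_simps)
  ultimately show "{Some u, Some v} \<in> merged_edges G" unfolding merged_edges_def by (metis imageI)
qed

lemma merge_source_edge: "i \<in> sources G \<Longrightarrow> merge G ` {leader_of G i, i} = {None, Some i}"
  using leader_of sources_followers by (auto simp: merge_simps)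

lemma merged_source_edge: "{None, Some v} \<in> merged_edges G \<longleftrightarrow> v \<in> sources G"
proof
  assume "{None, Some v} \<in> merged_edges G"
  then obtain e where e: "e \<in> edges G" "merge G ` e = {None, Some v}" by (auto simp: merged_edges_def)
  from e(1) show "v \<in> sources G"
  proof (cases rule: edge_cases)
    case (follower a b)
    from e(2)[unfolded follower(4)] show ?thesis by (simp add: doubleton_eq_iff)
  next
    case (source i)
    from e(2)[unfolded source(3)] source(1) show ?thesis by (simp add: doubleton_eq_iff)
  qed
next
  assume v: "v \<in> sources G"
  show "{None, Some v} \<in> merged_edges G"
    using leader_of(2)[OF v] merge_source_edge[OF v] unfolding merged_edges_def by (metis imageI)
qed

text \<open>Brings Kirchhoff's law in the merged graph into the form of
  \<open>laplacian_action\<close>: with potential zero at \<open>None\<close>, the edge to the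
  leader contributes its weight applied to the potential at \<open>v\<close>.\<close>

lemma outflow_merged:
  assumes v: "v \<in> followers G" and X: "\<And>v. X v \<in> carrier_vec k" and None: "X None = 0\<^sub>v k"
  shows "outflow (merged_weight G) (merged_edges G) X (Some v) p =
    (\<Sum>u | u \<in> followers G \<and> {u, v} \<in> edges G. (weight G {u, v} *\<^sub>v (X (Some v) - X (Some u))) $ p) +
    (if v \<in> sources G then (weight G {leader_of G v, v} *\<^sub>v X (Some v)) $ p else 0)"
proof -
  let ?N = "{u. u \<in> followers G \<and> {u, v} \<in> edges G}"
  let ?S = "if v \<in> sources G then {None} else {}"
  let ?f = "\<lambda>u. (merged_weight G {u, Some v} *\<^sub>v (X (Some v) - X u)) $ p"
  have "{u. {u, Some v} \<in> merged_edges G} = Some ` ?N \<union> ?S" (is "?L = ?R")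
  proof (rule Set.set_eqI)
    fix u show "u \<in> ?L \<longleftrightarrow> u \<in> ?R"
      by (cases u) (auto simp: merged_follower_edge[OF v] merged_source_edge)
  qed
  then have "outflow (merged_weight G) (merged_edges G) X (Some v) p = sum ?f (Some ` ?N \<union> ?S)"
    by (simp add: outflow_def)
  also have "\<dots> = sum ?f (Some ` ?N) + sum ?f ?S"
    using finite_followers by (intro sum.union_disjoint) auto
  also have "sum ?f (Some ` ?N) = (\<Sum>u\<in>?N. (weight G {u, v} *\<^sub>v (X (Some v) - X (Some u))) $ p)"
  proof (subst sum.reindex, simp, rule sum.cong)
    fix u assume u: "u \<in> ?N"
    then have "merge G ` {u, v} = {Some u, Some v}" using v by (simp add: merge_simps)
    then have "merged_weight G {Some u, Some v} = weight G {u, v}"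
      using merged_weight_merge[of "{u, v}"] u by simp
    then show "(?f \<circ> Some) u = (weight G {u, v} *\<^sub>v (X (Some v) - X (Some u))) $ p" by simp
  qed simp
  also have "sum ?f ?S = (if v \<in> sources G then (weight G {leader_of G v, v} *\<^sub>v X (Some v)) $ p else 0)"
  proof (cases "v \<in> sources G")
    case True
    then have "merged_weight G {None, Some v} = weight G {leader_of G v, v}"
      using merged_weight_merge[OF leader_of(2)[OF True]] merge_source_edge[OF True] by simp
    moreover have "X (Some v) - X None = X (Some v)" using X[of "Some v"] None by simp
    ultimately show ?thesis using True by simp
  qed simp
  finally show ?thesis .
qed

lemma merged_nodes_followers: "v \<in> followers G \<Longrightarrow> Some v \<in> merged_nodes G"
  unfolding merged_nodes_def by (rule image_eqI[of _ _ v]) (auto simp: merge_simps followers_def)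

section \<open>Diagonal blocks of the inverse as effective resistances\<close>

lemma laplacian_inverse:
  obtains U where "mat_inverse A = Some U" "U \<in> spd n" "A * U = 1\<^sub>m n" "U * A = 1\<^sub>m n"
  using spd_inverse[OF laplacian_spd] .

text \<open>The rows of A are the followers, so Kirchhoff's law at all nodes except the grounded
  sink reads A x = e_s i. As A is invertible, any potentials that satisfy it must be those given by
  the inverse.\<close>

lemma laplacian_inverse_column:
  assumes s: "s \<in> followers G" and i: "i \<in> carrier_vec k"
    and X: "electrical_flow k (merged_weight G) (merged_nodes G) (merged_edges G) (Some s) None i X"
  shows "transpose_mat (block_unit k G s) *\<^sub>v (the (mat_inverse A) *\<^sub>v (block_unit k G s *\<^sub>v i)) = X (Some s)"
proof -
  obtain U where U: "mat_inverse A = Some U" "U \<in> spd n" "A * U = 1\<^sub>m n" "U * A = 1\<^sub>m n"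
    using laplacian_inverse .
  note Uc = spd_carrier[OF U(2)]
  have Xc: "X v \<in> carrier_vec k" for v using X by (simp add: electrical_flow_def)
  \<comment> \<open>Stacks the potentials of the followers: \<open>r div k\<close> recovers the
    follower and \<open>r mod k\<close> the component.\<close>
  define x where "x = vec n (\<lambda>r. X (Some (inv_into (followers G) (follower_index G) (r div k))) $ (r mod k))"
  have x: "x \<in> carrier_vec n" by (simp add: x_def)
  have block: "block k G x v = X (Some v)" if v: "v \<in> followers G" for v
  proof (rule eq_vecI)
    fix p assume "p < dim_vec (X (Some v))"
    then have p: "p < k" using Xc[of "Some v"] by simp
    have "inv_into (followers G) (follower_index G) (follower_index G v) = v"
      using v bij_betw_follower_index by (simp add: bij_betw_def inv_into_f_f)
    then show "block k G x v $ p = X (Some v) $ p"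
      using p row_index_less[OF v p] by (simp add: block_def x_def)
  qed (use Xc[of "Some v"] in \<open>simp add: block_def\<close>)
  have Bi: "block_unit k G s *\<^sub>v i \<in> carrier_vec n" by (rule mult_mat_vec_carrier[OF block_unit_carrier i])
  have "A *\<^sub>v x = block_unit k G s *\<^sub>v i"
  proof (rule eq_vecI)
    fix r assume "r < dim_vec (block_unit k G s *\<^sub>v i)"
    then have "r < n" using Bi by simp
    then obtain v p where vp: "v \<in> followers G" "p < k" "r = follower_index G v * k + p"
      by (rule row_index_cases)
    have "(A *\<^sub>v x) $ r = outflow (merged_weight G) (merged_edges G) X (Some v) p"
      using X Xc vp laplacian_action[OF x vp(1,2)] outflow_merged[OF vp(1), of X p]
      by (simp add: electrical_flow_def block cong: if_cong)
    also have "\<dots> = (if v = s then i $ p else 0)"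
      using X vp merged_nodes_followers[OF vp(1)] by (simp add: electrical_flow_def)
    finally show "(A *\<^sub>v x) $ r = (block_unit k G s *\<^sub>v i) $ r"
      unfolding vp(3) by (simp only: block_unit_mult[OF s vp(1,2) i])
  qed (simp add: carrier_matD(1)[OF laplacian_carrier])
  then have "U *\<^sub>v (block_unit k G s *\<^sub>v i) = x"
    using assoc_mult_mat_vec[OF Uc laplacian_carrier x] U(4) x by simp
  then show ?thesis by (simp add: U(1) transpose_block_unit_mult[OF s x] block[OF s])
qed

text \<open>The value at the root and the block send every current \<open>i\<close> to the same
  potential at \<open>s\<close>; applied to unit vectors, this gives equal columns.\<close>

lemma tree_value_inverse_block:
  assumes s: "s \<in> followers G"
    and T: "decomposition_tree T (merged_nodes G) (merged_edges G) (Some s) None"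
  shows "tree_value resistance_algorithm k (merged_weight G) T =
    Some (transpose_mat (block_unit k G s) * the (mat_inverse A) * block_unit k G s)"
proof -
  let ?B = "block_unit k G s" and ?U = "the (mat_inverse A)"
  obtain R where R: "tree_value resistance_algorithm k (merged_weight G) T = Some R" "R \<in> spd k"
    "\<And>i. i \<in> carrier_vec k \<Longrightarrow>
      \<exists>X. electrical_flow k (merged_weight G) (merged_nodes G) (merged_edges G) (Some s) None i X \<and> X (Some s) = R *\<^sub>v i"
    using tree_value_resistance[where w = "merged_weight G", OF T merged_weight_spd] by blast
  have U: "?U \<in> carrier_mat n n" using laplacian_inverse spd_carrier by (metis option.sel)
  have Bt: "transpose_mat ?B \<in> carrier_mat k n" by simp
  note BtU = mult_carrier_mat[OF Bt U]
  note M = mult_carrier_mat[OF BtU block_unit_carrier]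
  have action: "(transpose_mat ?B * ?U * ?B) *\<^sub>v i = R *\<^sub>v i" if i: "i \<in> carrier_vec k" for i
  proof -
    obtain X where X: "electrical_flow k (merged_weight G) (merged_nodes G) (merged_edges G) (Some s) None i X"
        "X (Some s) = R *\<^sub>v i" using R(3)[OF i] by blast
    have Bi: "?B *\<^sub>v i \<in> carrier_vec n" by (rule mult_mat_vec_carrier[OF block_unit_carrier i])
    have "(transpose_mat ?B * ?U * ?B) *\<^sub>v i = transpose_mat ?B *\<^sub>v (?U *\<^sub>v (?B *\<^sub>v i))"
      by (simp only: assoc_mult_mat_vec[OF BtU block_unit_carrier i] assoc_mult_mat_vec[OF Bt U Bi])
    with laplacian_inverse_column[OF s i X(1)] X(2) show ?thesis by simp
  qed
  have "transpose_mat ?B * ?U * ?B = R"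
  proof (rule mat_col_eqI)
    fix j assume j: "j < dim_col R"
    then have j': "j < k" using spd_carrier[OF R(2)] by simp
    have "col N j = N *\<^sub>v unit_vec k j" if "N \<in> carrier_mat k k" for N :: "real mat"
      using that j' by (intro eq_vecI) auto
    with action[of "unit_vec k j"] M spd_carrier[OF R(2)]
    show "col (transpose_mat ?B * ?U * ?B) j = col R j" by simp
  qed (use M spd_carrier[OF R(2)] in auto)
  with R(1) show ?thesis by simp
qed

section \<open>The norm as a sum over sources and as the output of the algorithm\<close>

text \<open>The trace sees only products of a column with itself. Grouping the columns of the input
  matrix into runs of length k gives the columns of the single block units, without cross terms
  between sources.\<close>

lemma trace_input_matrix:
  assumes U: "U \<in> carrier_mat n n"
  shows "mat_trace (transpose_mat (input_matrix k G) * U * input_matrix k G) =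
    (\<Sum>s\<in>sources G. mat_trace (transpose_mat (block_unit k G s) * U * block_unit k G s))"
proof -
  let ?B = "input_matrix k G" and ?l = "sorted_list_of_set (sources G)" and ?m = "card (sources G)"
  have B: "?B \<in> carrier_mat n (?m * k)" by (simp add: input_matrix_def)
  have col: "col ?B (j * k + q) = col (block_unit k G (?l ! j)) q" if "j < ?m" "q < k" for j q
  proof -
    have "Suc j * k \<le> ?m * k" using that(1) by (intro mult_le_mono1) simp
    then have "j * k + q < ?m * k" using that(2) by simp
    then show ?thesis using that(2) by (intro eq_vecI) (simp_all add: input_matrix_def)
  qed
  let ?g = "\<lambda>s. mat_trace (transpose_mat (block_unit k G s) * U * block_unit k G s)"
  let ?h = "\<lambda>b. col ?B b \<bullet> (U *\<^sub>v col ?B b)"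
  have "sum ?h {j * k..<j * k + k} = ?g (?l ! j)" if j: "j < ?m" for j
  proof -
    have "sum ?h {j * k..<j * k + k} = (\<Sum>q<k. ?h (j * k + q))"
      using sum.shift_bounds_nat_ivl[of ?h 0 "j * k" k] by (simp add: atLeast0LessThan add.commute)
    also have "\<dots> = ?g (?l ! j)"
      unfolding mat_trace_congruence[OF U block_unit_carrier] using col[OF j] by simp
    finally show ?thesis .
  qed
  then have "mat_trace (transpose_mat ?B * U * ?B) = (\<Sum>j<?m. ?g (?l ! j))"
    unfolding mat_trace_congruence[OF U B] sum.nat_group[symmetric] by simp
  also have "\<dots> = sum ?g (sources G)"
  proof (rule sum.reindex_bij_betw)
    show "bij_betw ((!) ?l) {..<?m} (sources G)"
      using finite_sources by (intro bij_betw_nth) auto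
  qed
  finally show ?thesis .
qed

lemma consensus_h2_eq:
  assumes "B \<in> carrier_mat n m"
  shows "consensus_h2 k G B = sqrt (1 / 2 * mat_trace (transpose_mat B * the (mat_inverse A) * B))"
  unfolding consensus_h2_def by (rule h2_norm_spd[OF laplacian_spd assms])

lemma consensus_h2_square:
  assumes B: "B \<in> carrier_mat n m"
  shows "(consensus_h2 k G B)\<^sup>2 = 1 / 2 * mat_trace (transpose_mat B * the (mat_inverse A) * B)"
proof -
  have "the (mat_inverse A) \<in> spd n" using laplacian_inverse by (metis option.sel)
  from mat_trace_congruence_nonneg[OF this B] show ?thesis
    unfolding consensus_h2_eq[OF B] by simp
qed

lemma input_matrix_carrier: "input_matrix k G \<in> carrier_mat n (card (sources G) * k)"
  by (simp add: input_matrix_def)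

lemma trace_input_matrix_inverse:
  "mat_trace (transpose_mat (input_matrix k G) * the (mat_inverse A) * input_matrix k G) =
    (\<Sum>s\<in>sources G. mat_trace (transpose_mat (block_unit k G s) * the (mat_inverse A) * block_unit k G s))"
  using laplacian_inverse spd_carrier by (intro trace_input_matrix) (metis option.sel)

lemma consensus_h2_sources:
  "(consensus_h2 k G (input_matrix k G))\<^sup>2 = (\<Sum>s\<in>sources G. (consensus_h2 k G (block_unit k G s))\<^sup>2)"
  unfolding consensus_h2_square[OF input_matrix_carrier] consensus_h2_square[OF block_unit_carrier]
    trace_input_matrix_inverse by (simp add: sum_distrib_left)

lemma resistance_algorithm_output:
  assumes D: "source_trees G D"
  shows "algorithm_output resistance_algorithm k G D = Some (consensus_h2 k G (input_matrix k G))"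
proof -
  let ?g = "\<lambda>s. mat_trace (transpose_mat (block_unit k G s) * the (mat_inverse A) * block_unit k G s)"
  let ?Ts = "map D (sorted_list_of_set (sources G))"
  have root: "tree_value resistance_algorithm k (merged_weight G) (D s) =
      Some (transpose_mat (block_unit k G s) * the (mat_inverse A) * block_unit k G s)" if "s \<in> sources G" for s
    using D that sources_followers by (intro tree_value_inverse_block) (auto simp: source_trees_def)
  have "accumulate_trees resistance_algorithm k (merged_weight G) ?Ts 0 =
      Some (0 + (\<Sum>T\<leftarrow>?Ts. mat_trace (the (tree_value resistance_algorithm k (merged_weight G) T))))"
    using finite_sources root by (intro accumulate_trees_resistance) auto
  also have "(\<Sum>T\<leftarrow>?Ts. mat_trace (the (tree_value resistance_algorithm k (merged_weight G) T))) =
      (\<Sum>s\<in>sources G. mat_trace (the (tree_value resistance_algorithm k (merged_weight G) (D s))))"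
    using finite_sources by (simp add: sum_list_distinct_conv_sum_set comp_def)
  also have "\<dots> = sum ?g (sources G)" by (intro sum.cong refl) (simp add: root)
  finally have "accumulate_trees resistance_algorithm k (merged_weight G) ?Ts 0 = Some (sum ?g (sources G))"
    by simp
  then have "algorithm_output resistance_algorithm k G D = Some (sqrt (1 / 2 * sum ?g (sources G)))"
    by (simp add: algorithm_output_def) (simp add: resistance_algorithm_def of_rat_divide)
  then show ?thesis
    by (simp only: consensus_h2_eq[OF input_matrix_carrier] trace_input_matrix_inverse)
qed

section \<open>Complexity bounds\<close>

lemma card_sources: "card (sources G) = card (leaders G)"
  by (rule bij_betw_same_card[OF bij_betw_sources_leaders])

lemma card_leaders_pos: "0 < card (leaders G)"
  using leaders_nonempty leaders_nodes finite_nodes by (metis card_gt_0_iff finite_subset less_imp_le)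

lemma card_nodes_ge_2: "2 \<le> card (nodes G)"
  using psubset_card_mono[OF finite_nodes leaders_nodes] card_leaders_pos by linarith

lemma source_tree_height_le:
  assumes "source_trees G D" "s \<in> sources G"
  shows "tree_height (D s) \<le> 2 * card (nodes G)"
proof -
  have "card (merged_nodes G) \<le> card (nodes G)"
    unfolding merged_nodes_def by (rule card_image_le[OF finite_nodes])
  moreover have "tree_height (D s) + 4 \<le> 2 * card (merged_nodes G)"
    using assms tree_height_le by (metis source_trees_def)
  ultimately show ?thesis by linarith
qed

end

text \<open>The asymptotic bound may fail for finitely many k. Adding the values there to the
  constant repairs this, since \<open>real k powr a\<close> is at least 1 for k >= 1.\<close>

lemma bigo_powr_bound:
  assumes f: "(\<lambda>k. real (f k)) \<in> O(\<lambda>k. real k powr a)" and a: "0 \<le> a"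
  obtains C where "0 \<le> C" "\<And>k. 1 \<le> k \<Longrightarrow> real (f k) \<le> C * real k powr a"
proof -
  obtain c where c: "0 < c" "eventually (\<lambda>k. norm (real (f k)) \<le> c * norm (real k powr a)) at_top"
    using landau_o.bigE[OF f] by blast
  then obtain N where N: "\<And>k. N \<le> k \<Longrightarrow> real (f k) \<le> c * real k powr a"
    by (auto simp: eventually_at_top_linorder)
  define C where "C = c + (\<Sum>k<N. real (f k))"
  have "real (f k) \<le> C * real k powr a" if k: "1 \<le> k" for k
  proof (cases "N \<le> k")
    case True
    have "c * real k powr a \<le> C * real k powr a"
      unfolding C_def by (intro mult_right_mono) (auto intro: sum_nonneg)
    with N[OF True] show ?thesis by linarith
  next
    case False
    then have "real (f k) \<le> (\<Sum>k<N. real (f k))" by (intro member_le_sum) auto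
    also have "\<dots> \<le> C * 1" using c(1) by (simp add: C_def)
    also have "\<dots> \<le> C * real k powr a"
      using k a c(1) by (intro mult_left_mono ge_one_powr_ge_zero) (auto simp: C_def intro!: add_nonneg_nonneg sum_nonneg)
    finally show ?thesis .
  qed
  moreover have "0 \<le> C" using c(1) by (auto simp: C_def intro!: add_nonneg_nonneg sum_nonneg)
  ultimately show thesis using that by blast
qed

text \<open>\<open>C\<close> is chosen before k, the graph and the trees, and the height bound
  \<open>H\<close> stays a parameter, so that one estimate covers both the logarithmic and the
  linear case.\<close>

lemma resistance_algorithm_cost:
  assumes \<omega>: "matrix_exponent \<omega> mc"
  obtains C :: real where "0 \<le> C"
    "\<And>k G D H. \<lbrakk>1 \<le> k; leader_follower k G; \<And>s. s \<in> sources G \<Longrightarrow> real (tree_height (D s)) \<le> H\<rbrakk> \<Longrightarrow>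
      real (algorithm_cost resistance_algorithm mc k G D) \<le>
        real k powr \<omega> * real (card (leaders G)) * (C * (H + 1) + 8)"
proof -
  have \<omega>2: "2 \<le> \<omega>" and inv: "(\<lambda>k. real (inv_cost mc k)) \<in> O(\<lambda>k. real k powr \<omega>)"
    using \<omega> by (auto simp: matrix_exponent_def)
  obtain C where C: "0 \<le> C" "\<And>k. 1 \<le> k \<Longrightarrow> real (inv_cost mc k) \<le> C * real k powr \<omega>"
    using bigo_powr_bound[OF inv] \<omega>2 by (metis order_trans zero_le_numeral)
  have main: "real (algorithm_cost resistance_algorithm mc k G D) \<le>
        real k powr \<omega> * real (card (leaders G)) * ((3 + 3 * C) * (H + 1) + 8)"
    if k: "1 \<le> k" and lf: "leader_follower k G" and H: "\<And>s. s \<in> sources G \<Longrightarrow> real (tree_height (D s)) \<le> H"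
    for k G and D :: "nat \<Rightarrow> nat option set sp_tree" and H
  proof -
    interpret leader_follower_graph k G by unfold_locales (rule lf)
    define P where "P = real k powr \<omega>"
    let ?a = "resistance_algorithm"
    \<comment> \<open>The cost of a parallel join, the most expensive kind of node: three
      inversions, two reads and one addition.\<close>
    let ?M = "3 * k\<^sup>2 + 3 * inv_cost mc k"
    have "real k powr 2 \<le> P" unfolding P_def using k \<omega>2 by (intro powr_mono) auto
    then have k2: "(real k)\<^sup>2 \<le> P" using k by (simp add: powr_numeral)
    moreover have "real k \<le> (real k)\<^sup>2" using k by (simp add: power2_eq_square)
    moreover have "1 \<le> real k" using k by simp
    ultimately have P: "real k \<le> P" "1 \<le> P" by linarith+
    have "tree_cost ?a mc k (D s) \<le> (tree_height (D s) + 1) * ?M" for s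
      by (intro tree_cost_le) (simp_all add: resistance_algorithm_def)
    then have "real (tree_cost ?a mc k (D s)) \<le> real ((tree_height (D s) + 1) * ?M)" for s
      by (simp only: of_nat_le_iff)
    moreover have "real ((tree_height (D s) + 1) * ?M) \<le> (H + 1) * ((3 + 3 * C) * P)" if "s \<in> sources G" for s
    proof -
      have "real ?M \<le> (3 + 3 * C) * P"
        using k2 C(2)[OF k] by (simp add: P_def algebra_simps)
      then show ?thesis using H[OF that] unfolding of_nat_mult by (intro mult_mono) auto
    qed
    moreover have scost: "real (scost mc k (accumulate ?a)) \<le> 4 * P" "real (scost mc k (finish ?a)) \<le> 4 * P"
      using k2 P by (simp_all add: resistance_algorithm_def)
    ultimately have "real (tree_cost ?a mc k (D s) + scost mc k (accumulate ?a)) \<le>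
        (H + 1) * ((3 + 3 * C) * P) + 4 * P" if "s \<in> sources G" for s
      using that by (smt (verit) of_nat_add)
    then have "(\<Sum>s\<in>sources G. real (tree_cost ?a mc k (D s) + scost mc k (accumulate ?a))) \<le>
        real (card (sources G)) * ((H + 1) * ((3 + 3 * C) * P) + 4 * P)"
      by (rule sum_bounded_above)
    then have "real (algorithm_cost ?a mc k G D) \<le>
        real (card (leaders G)) * ((H + 1) * ((3 + 3 * C) * P) + 4 * P) + 4 * P"
      using scost(2) unfolding algorithm_cost_def card_sources of_nat_add of_nat_sum by linarith
    \<comment> \<open>The final step is paid only once, but charging it to every leader is
      affordable as there is at least one. Together with the accumulation step this makes the
      constant 8 = 4 + 4.\<close>
    moreover have "4 * P \<le> real (card (leaders G)) * (4 * P)"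
    proof -
      have "1 * (4 * P) \<le> real (card (leaders G)) * (4 * P)"
        using card_leaders_pos P by (intro mult_right_mono) auto
      then show ?thesis by simp
    qed
    ultimately have "real (algorithm_cost ?a mc k G D) \<le>
        real (card (leaders G)) * ((H + 1) * ((3 + 3 * C) * P) + 4 * P) + real (card (leaders G)) * (4 * P)"
      by linarith
    then show ?thesis by (simp add: P_def algebra_simps)
  qed
  show thesis by (rule that[of "3 + 3 * C"]) (use C(1) main in auto)
qed

theorem theorem2:
  fixes \<omega> :: real and mc :: matrix_costs
  assumes "matrix_exponent \<omega> mc"
  shows
    "(\<forall>k G. k \<ge> 1 \<and> leader_follower k G \<and> aittsp G \<longrightarrow>
        (consensus_h2 k G (input_matrix k G))\<^sup>2 =
          1 / 2 * mat_trace (transpose_mat (input_matrix k G) *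
                             the (mat_inverse (dirichlet_laplacian k G)) * input_matrix k G) \<and>
        (consensus_h2 k G (input_matrix k G))\<^sup>2 =
          (\<Sum>s\<in>sources G. (consensus_h2 k G (block_unit k G s))\<^sup>2)) \<and>
     (\<exists>alg.
        (\<forall>k G D. k \<ge> 1 \<and> leader_follower k G \<and> aittsp G \<and> source_trees G D \<longrightarrow>
           algorithm_output alg k G D = Some (consensus_h2 k G (input_matrix k G))) \<and>
        (\<forall>c::real. \<exists>K::real. \<forall>k G D.
           k \<ge> 1 \<and> leader_follower k G \<and> aittsp G \<and> source_trees G D \<and>
           (\<forall>s\<in>sources G. real (tree_height (D s)) \<le> c * ln (real (card (nodes G)))) \<longrightarrow>
           real (algorithm_cost alg mc k G D) \<le>
             K * (real k powr \<omega> * real (card (leaders G)) * ln (real (card (nodes G))))) \<and>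
        (\<exists>K::real. \<forall>k G D.
           k \<ge> 1 \<and> leader_follower k G \<and> aittsp G \<and> source_trees G D \<longrightarrow>
           real (algorithm_cost alg mc k G D) \<le>
             K * (real k powr \<omega> * real (card (leaders G)) * real (card (nodes G)))))"
proof -
  obtain C where C: "0 \<le> C"
    "\<And>k G D H. \<lbrakk>1 \<le> k; leader_follower k G; \<And>s. s \<in> sources G \<Longrightarrow> real (tree_height (D s)) \<le> H\<rbrakk> \<Longrightarrow>
      real (algorithm_cost resistance_algorithm mc k G D) \<le>
        real k powr \<omega> * real (card (leaders G)) * (C * (H + 1) + 8)"
    using resistance_algorithm_cost[OF assms] by blast
  have h2: "(consensus_h2 k G (input_matrix k G))\<^sup>2 =
          1 / 2 * mat_trace (transpose_mat (input_matrix k G) *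
                             the (mat_inverse (dirichlet_laplacian k G)) * input_matrix k G) \<and>
        (consensus_h2 k G (input_matrix k G))\<^sup>2 =
          (\<Sum>s\<in>sources G. (consensus_h2 k G (block_unit k G s))\<^sup>2)" if "leader_follower k G" for k G
  proof -
    interpret leader_follower_graph k G by unfold_locales (rule that)
    show ?thesis using consensus_h2_square[OF input_matrix_carrier] consensus_h2_sources by simp
  qed
  have out: "algorithm_output resistance_algorithm k G D = Some (consensus_h2 k G (input_matrix k G))"
    if "leader_follower k G" "source_trees G D" for k G D
  proof -
    interpret leader_follower_graph k G by unfold_locales (rule that)
    show ?thesis by (rule resistance_algorithm_output[OF that(2)])
  qed
  have best: "real (algorithm_cost resistance_algorithm mc k G D) \<le>
      (C * c + (C + 8) / ln 2) * (real k powr \<omega> * real (card (leaders G)) * ln (real (card (nodes G))))"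
    if k: "1 \<le> k" and lf: "leader_follower k G"
      and H: "\<forall>s\<in>sources G. real (tree_height (D s)) \<le> c * ln (real (card (nodes G)))" for c k G D
  proof -
    interpret leader_follower_graph k G by unfold_locales (rule lf)
    let ?L = "ln (real (card (nodes G)))"
    have "ln 2 \<le> ?L" using card_nodes_ge_2 by simp
    \<comment> \<open>With H = c L the cost factor is C c L + (C + 8). Since L >= ln 2, the additive
      part is at most (C + 8) L / ln 2.\<close>
    then have "(C + 8) * 1 \<le> (C + 8) * (?L / ln 2)" using C(1) by (intro mult_left_mono) auto
    then have "C * (c * ?L + 1) + 8 \<le> (C * c + (C + 8) / ln 2) * ?L" by (simp add: algebra_simps)
    then have "real k powr \<omega> * real (card (leaders G)) * (C * (c * ?L + 1) + 8) \<le>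
        real k powr \<omega> * real (card (leaders G)) * ((C * c + (C + 8) / ln 2) * ?L)"
      by (intro mult_left_mono) auto
    with C(2)[OF k lf, of D "c * ?L"] H show ?thesis by (simp add: mult_ac)
  qed
  have worst: "real (algorithm_cost resistance_algorithm mc k G D) \<le>
      (3 * C + 8) * (real k powr \<omega> * real (card (leaders G)) * real (card (nodes G)))"
    if k: "1 \<le> k" and lf: "leader_follower k G" and D: "source_trees G D" for k G D
  proof -
    interpret leader_follower_graph k G by unfold_locales (rule lf)
    let ?N = "real (card (nodes G))"
    have H: "real (tree_height (D s)) \<le> 2 * ?N" if "s \<in> sources G" for s
      using source_tree_height_le[OF D that] by linarith
    have "1 \<le> ?N" using card_nodes_ge_2 by simp
    \<comment> \<open>With H = 2 |N| the cost factor is 2 C |N| + (C + 8), and |N| >= 1 bounds it by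
      (3 C + 8) |N|.\<close>
    then have "(C + 8) * 1 \<le> (C + 8) * ?N" using C(1) by (intro mult_left_mono) auto
    then have "C * (2 * ?N + 1) + 8 \<le> (3 * C + 8) * ?N" by (simp add: algebra_simps)
    then have "real k powr \<omega> * real (card (leaders G)) * (C * (2 * ?N + 1) + 8) \<le>
        real k powr \<omega> * real (card (leaders G)) * ((3 * C + 8) * ?N)"
      by (intro mult_left_mono) auto
    with C(2)[OF k lf, of D "2 * ?N", OF H] show ?thesis by (simp add: mult_ac)
  qed
  show ?thesis
    by (intro conjI allI impI exI[of _ resistance_algorithm])
      (use h2 out best worst in blast)+
qed

end
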